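(* Let $u\in V$ be quasiprimary of weight $N\ge1$, inserted at $x$, and let $v_1,\ldots,v_n\in V$ be inserted at $y_1,\ldots,y_n$. For arbitrary formal Laurent series $f_0(x),\ldots,f_{2N-2}(x)$ put $$\pi_N(x,y)=\frac1{x-y}+\sum_{\ell=0}^{2N-2}f_\ell(x)y^\ell.$$ Then $$Z^{(0)}(u,x;v_1,y_1;\ldots;v_n,y_n)=\sum_{k=1}^n\sum_{j\ge0}\pi_N^{(0,j)}(x,y_k)\,Z^{(0)}(\ldots;u(j)v_k,y_k;\ldots),$$ where on the right $v_k$ is replaced by $u(j)v_k$ in the $n$-point function of $v_1,\ldots,v_n$.
   Context: $V=(V,Y,\mathbf 1,\omega)$ is a simple vertex operator algebra over $\mathbb C$ of strong CFT type ($V=\bigoplus_{n\ge0}V_n$, $\dim V_n<\infty$, $V_0=\mathbb C\mathbf 1$, $L(1)V_1=0$), isomorphic to its contragredient module $V'$. $Y(u,z)=\sum_nu(n)z^{-n-1}$, $Y(\omega,z)=\sum_nL(n)z^{-n-2}$. $u$ is quasiprimary of weight $N$ if $u\in V_N$ and $L(1)u=0$. $\langle\cdot,\cdot\rangle$ is the unique non-degenerate invariant bilinear form on $V$ with $\langle\mathbf 1,\mathbf 1\rangle=1$: $\langle Y(u,z)v,w\rangle=\langle v,Y(e^{zL(1)}(-z^{-2})^{L(0)}u,z^{-1})w\rangle$. $Z^{(0)}(v_1,y_1;\ldots;v_n,y_n)=\langle\mathbf 1,Y(v_1,y_1)\cdots Y(v_n,y_n)\mathbf 1\rangle$, extended to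 a rational function of the $y_k$. $\pi_N^{(0,j)}(x,y)=\frac1{j!}\partial_y^j\pi_N(x,y)$; when read formally, $(x-y)^{-1}$ is expanded in non-negative powers of $y$. *)

theory Defs
  imports
    "HOL-Analysis.Analysis"
    "HOL-Computational_Algebra.Polynomial"
    "HOL-Library.Groups_Big_Fun"
begin

section \<open>Vertex operator algebras\<close>

text \<open>The underlying vector space is the whole type \<open>'v\<close>. The vector \<open>mode V u n v\<close> is
  \<open>u(n)v\<close>, where \<open>Y(u,z) = (\<Sum>n. u(n) z^(-n-1))\<close>.\<close>

record 'v voa_data =
  scal :: "complex \<Rightarrow> 'v \<Rightarrow> 'v"
  mode :: "'v \<Rightarrow> int \<Rightarrow> 'v \<Rightarrow> 'v"
  vac  :: 'v
  conf :: 'v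

definition L :: "('v, 'm) voa_data_scheme \<Rightarrow> int \<Rightarrow> 'v \<Rightarrow> 'v" where
  "L V n = mode V (conf V) (n + 1)"

definition weight_space :: "('v::ab_group_add) voa_data \<Rightarrow> int \<Rightarrow> 'v set" where
  "weight_space V n = {v. L V 0 v = scal V (of_int n) v}"

text \<open>Sums over all indices are written with the constant \<open>Sum_any\<close>, the sum over the support
  of the summand. By \<open>truncation\<close> all of them have finite support. The axiom \<open>borcherds\<close> is the
  Jacobi identity in components.\<close>

locale vertex_algebra =
  fixes V :: "('v::ab_group_add) voa_data"
  assumes vector_space: "vector_space (scal V)"
    and mode_linear_left: "Vector_Spaces.linear (scal V) (scal V) (\<lambda>u. mode V u n v)"
    and mode_linear_right: "Vector_Spaces.linear (scal V) (scal V) (mode V u n)"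
    and truncation: "\<exists>n0. \<forall>n\<ge>n0. mode V u n v = 0"
    and vacuum: "mode V (vac V) n v = (if n = -1 then v else 0)"
    and creation: "mode V u (-1) (vac V) = u"
    and creation_nonneg: "n \<ge> 0 \<Longrightarrow> mode V u n (vac V) = 0"
    and borcherds:
      "Sum_any (\<lambda>i::nat. scal V (of_int m gchoose i)
           (mode V (mode V u (l + int i) v) (m + n - int i) w))
       = Sum_any (\<lambda>i::nat. scal V ((-1) ^ i * (of_int l gchoose i))
           (mode V u (m + l - int i) (mode V v (n + int i) w)))
       - Sum_any (\<lambda>i::nat. scal V ((-1) ^ i * (of_int l gchoose i) * (-1) powi l)
           (mode V v (n + l - int i) (mode V u (m + int i) w)))"

locale vertex_operator_algebra = vertex_algebra +
  assumes virasoro: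
      "\<exists>c. \<forall>m n v. L V m (L V n v) - L V n (L V m v)
         = scal V (of_int (m - n)) (L V (m + n) v)
           + (if m + n = 0 then scal V ((of_int m ^ 3 - of_int m) / 12 * c) v else 0)"
    and translation: "mode V (L V (-1) u) n v = scal V (- of_int n) (mode V u (n - 1) v)"
    and grading: "module.span (scal V) (\<Union>n. weight_space V n) = UNIV"
    and weight_finite_dim:
      "\<exists>S. finite S \<and> module.span (scal V) S = weight_space V n"
    and weight_bounded_below: "\<exists>n0. \<forall>n<n0. weight_space V n = {0}"

text \<open>Simplicity is irreducibility of the adjoint module.\<close>

definition simple_voa :: "('v::ab_group_add) voa_data \<Rightarrow> bool" where
  "simple_voa V \<longleftrightarrow> (\<exists>v::'v. v \<noteq> 0) \<and>
     (\<forall>I. module.subspace (scal V) I \<and> (\<forall>u n. \<forall>v\<in>I. mode V u n v \<in> I)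
        \<longrightarrow> I = {0} \<or> I = UNIV)"

definition strong_CFT_type :: "('v::ab_group_add) voa_data \<Rightarrow> bool" where
  "strong_CFT_type V \<longleftrightarrow>
     (\<forall>n<0. weight_space V n = {0}) \<and>
     weight_space V 0 = module.span (scal V) {vac V} \<and>
     (\<forall>v \<in> weight_space V 1. L V 1 v = 0)"

definition quasiprimary :: "('v::ab_group_add) voa_data \<Rightarrow> nat \<Rightarrow> 'v \<Rightarrow> bool" where
  "quasiprimary V N u \<longleftrightarrow> u \<in> weight_space V (int N) \<and> L V 1 u = 0"

section \<open>The contragredient module and invariant forms\<close>

text \<open>For \<open>u\<close> of weight \<open>N\<close>, \<open>adjoint_mode V N u n\<close> is the coefficient of \<open>z^(-n-1)\<close> in
  \<open>Y(e^(zL(1)) (-z^(-2))^L(0) u, z^(-1)) = (\<Sum>k m. (-1)^N / k! (L(1)^k u)(m) z^(k-2N+m+1))\<close>,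
  so that \<open>m = 2N - n - k - 2\<close>. Conditions on general \<open>u\<close> are imposed on homogeneous \<open>u\<close>,
  which is enough by linearity.\<close>

definition adjoint_mode :: "('v::ab_group_add) voa_data \<Rightarrow> int \<Rightarrow> 'v \<Rightarrow> int \<Rightarrow> 'v \<Rightarrow> 'v" where
  "adjoint_mode V N u n w = Sum_any (\<lambda>k::nat. scal V ((-1) powi N / fact k)
      (mode V ((L V 1 ^^ k) u) (2 * N - n - int k - 2) w))"

definition restricted_dual :: "('v::ab_group_add) voa_data \<Rightarrow> ('v \<Rightarrow> complex) set" where
  "restricted_dual V = {\<phi>. Vector_Spaces.linear (scal V) (*) \<phi> \<and>
      finite {n. \<exists>v \<in> weight_space V n. \<phi> v \<noteq> 0}}"

definition contragredient_mode ::
    "('v::ab_group_add) voa_data \<Rightarrow> int \<Rightarrow> 'v \<Rightarrow> int \<Rightarrow> ('v \<Rightarrow> complex) \<Rightarrow> ('v \<Rightarrow> complex)" where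
  "contragredient_mode V N u n \<phi> = (\<lambda>w. \<phi> (adjoint_mode V N u n w))"

definition self_contragredient :: "('v::ab_group_add) voa_data \<Rightarrow> bool" where
  "self_contragredient V \<longleftrightarrow>
     (\<exists>\<Phi>. bij_betw \<Phi> UNIV (restricted_dual V) \<and>
          (\<forall>v w x. \<Phi> (v + w) x = \<Phi> v x + \<Phi> w x) \<and>
          (\<forall>a v x. \<Phi> (scal V a v) x = a * \<Phi> v x) \<and>
          (\<forall>N. \<forall>u \<in> weight_space V N. \<forall>n v.
             \<Phi> (mode V u n v) = contragredient_mode V N u n (\<Phi> v)))"

definition normalized_invariant_form ::
    "('v::ab_group_add) voa_data \<Rightarrow> ('v \<Rightarrow> 'v \<Rightarrow> complex) \<Rightarrow> bool" where
  "normalized_invariant_form V B \<longleftrightarrow>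
     (\<forall>v. Vector_Spaces.linear (scal V) (*) (B v)) \<and>
     (\<forall>w. Vector_Spaces.linear (scal V) (*) (\<lambda>v. B v w)) \<and>
     (\<forall>v. (\<forall>w. B v w = 0) \<longrightarrow> v = 0) \<and>
     (\<forall>w. (\<forall>v. B v w = 0) \<longrightarrow> w = 0) \<and>
     (\<forall>N. \<forall>u \<in> weight_space V N. \<forall>n v w.
        B (mode V u n v) w = B v (adjoint_mode V N u n w)) \<and>
     B (vac V) (vac V) = 1"

section \<open>Genus zero correlation functions\<close>

text \<open>Coefficient of \<open>y_1^(e_1) \<dots> y_n^(e_n)\<close> in the formal series
  \<open>\<langle>1, Y(v_1,y_1) \<dots> Y(v_n,y_n) 1\<rangle>\<close>; the lists \<open>vs\<close> and \<open>es\<close> have the same length.\<close>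

definition Z0_coeff ::
    "('v::ab_group_add) voa_data \<Rightarrow> ('v \<Rightarrow> 'v \<Rightarrow> complex) \<Rightarrow> 'v list \<Rightarrow> int list \<Rightarrow> complex" where
  "Z0_coeff V B vs es =
     B (vac V) (foldr (\<lambda>(v, e) w. mode V v (- e - 1) w) (zip vs es) (vac V))"

definition polynomial_fun :: "nat \<Rightarrow> (complex list \<Rightarrow> complex) \<Rightarrow> bool" where
  "polynomial_fun n P \<longleftrightarrow> (\<exists>A c. finite A \<and> A \<subseteq> {as :: nat list. length as = n} \<and>
     (\<forall>ys. length ys = n \<longrightarrow> P ys = (\<Sum>as\<in>A. c as * (\<Prod>i<n. (ys ! i) ^ (as ! i)))))"

text \<open>Rational functions of \<open>n\<close> variables whose only poles are along the diagonals
  \<open>y_i = y_j\<close>, as functions of \<open>n\<close> distinct points; the value elsewhere is \<open>0\<close> by convention.\<close>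

definition rational_on_config :: "nat \<Rightarrow> (complex list \<Rightarrow> complex) \<Rightarrow> bool" where
  "rational_on_config n R \<longleftrightarrow> (\<exists>P b. polynomial_fun n P \<and>
     (\<forall>ys. R ys = (if length ys = n \<and> distinct ys
        then P ys / (\<Prod>j<n. \<Prod>i<j. (ys ! i - ys ! j) ^ b) else 0)))"

text \<open>The rational function to which the series sums in the domain
  \<open>\<bar>y_1\<bar> > \<dots> > \<bar>y_n\<bar> > 0\<close>.\<close>

definition Z0 ::
    "('v::ab_group_add) voa_data \<Rightarrow> ('v \<Rightarrow> 'v \<Rightarrow> complex) \<Rightarrow> 'v list \<Rightarrow> complex list \<Rightarrow> complex" where
  "Z0 V B vs = (THE R. rational_on_config (length vs) R \<and>
     (\<forall>ys. length ys = length vs \<and> sorted_wrt (\<lambda>a b. cmod a > cmod b) ys \<and> 0 \<notin> set ys \<longrightarrow>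
        ((\<lambda>es. Z0_coeff V B vs es * (\<Prod>i<length vs. (ys ! i) powi (es ! i))) has_sum R ys)
          {es. length es = length vs}))"

section \<open>The kernel\<close>

text \<open>The kernel \<open>\<pi>_N(x,y)\<close> for functions \<open>f_l(x)\<close>, and \<open>\<pi>_N^(0,j) = (1/j!) (d/dy)^j \<pi>_N\<close>.\<close>

definition pi_kernel :: "nat \<Rightarrow> (nat \<Rightarrow> complex \<Rightarrow> complex) \<Rightarrow> complex \<Rightarrow> complex \<Rightarrow> complex" where
  "pi_kernel N f x y = 1 / (x - y) + (\<Sum>l\<le>2 * N - 2. f l x * y ^ l)"

definition pi_kernel_deriv ::
    "nat \<Rightarrow> (nat \<Rightarrow> complex \<Rightarrow> complex) \<Rightarrow> nat \<Rightarrow> complex \<Rightarrow> complex \<Rightarrow> complex" where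
  "pi_kernel_deriv N f j x y = (deriv ^^ j) (pi_kernel N f x) y / fact j"

text \<open>The kernel for formal Laurent series \<open>f_l\<close>, where \<open>f l a\<close> is the coefficient of \<open>x^a\<close> in
  \<open>f_l\<close> and no boundedness of the exponents is required. Since
  \<open>(x-y)^(-1) = (\<Sum>b\<ge>0. y^b x^(-b-1))\<close>, the coefficient of each \<open>x^a\<close> in \<open>\<pi>_N\<close> is a polynomial
  in \<open>y\<close>; it is \<open>formal_pi_kernel N f a\<close>.\<close>

definition formal_pi_kernel :: "nat \<Rightarrow> (nat \<Rightarrow> int \<Rightarrow> complex) \<Rightarrow> int \<Rightarrow> complex poly" where
  "formal_pi_kernel N f a =
     (if a < 0 then monom 1 (nat (- a - 1)) else 0) + (\<Sum>l\<le>2 * N - 2. monom (f l a) l)"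

definition formal_pi_kernel_deriv ::
    "nat \<Rightarrow> (nat \<Rightarrow> int \<Rightarrow> complex) \<Rightarrow> nat \<Rightarrow> int \<Rightarrow> complex poly" where
  "formal_pi_kernel_deriv N f j a = smult (1 / fact j) ((pderiv ^^ j) (formal_pi_kernel N f a))"

text \<open>Coefficient of \<open>y_1^(e_1) \<dots> y_n^(e_n)\<close> in the product of the polynomial \<open>p(y_(k+1))\<close>
  with the formal series with coefficients \<open>S\<close> (lists are indexed from \<open>0\<close>).\<close>

definition poly_times_series ::
    "complex poly \<Rightarrow> nat \<Rightarrow> (int list \<Rightarrow> complex) \<Rightarrow> int list \<Rightarrow> complex" where
  "poly_times_series p k S es = (\<Sum>b\<le>degree p. coeff p b * S (es[k := es ! k - int b]))"

end

theory Submission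
  imports Defs
begin

text \<open>
  Two facts about the functional \<open>w \<mapsto> \<langle>1, w\<rangle>\<close> drive the proof. Since the form is invariant
  and \<open>\<omega>\<close> is quasiprimary of weight 2, \<open>L(0)\<close> is self-adjoint, so this functional vanishes on all
  vectors of non-zero weight. As the weights are non-negative and \<open>V\<^sub>0\<close> is spanned by the vacuum,
  it follows that \<open>\<langle>1, u(m)w\<rangle> = 0\<close> for every \<open>u\<close> and every \<open>m < -1\<close>, while
  \<open>\<langle>1, u(-1)w\<rangle> = \<langle>1, u\<rangle>\<langle>1, w\<rangle>\<close> (lemma \<open>vac_mode_negative\<close>). If \<open>u\<close> is quasiprimary of weight
  \<open>N\<close>, then the adjoint of \<open>u(m)\<close> is \<open>u(2N-2-m)\<close> up to sign, and this mode kills the vacuum as soon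
  as \<open>m \<le> 2N-2\<close>; hence \<open>\<langle>1, u(m)w\<rangle> = 0\<close> for all \<open>m \<le> 2N-2\<close>
  (lemma \<open>vac_mode_quasiprimary_eq_0\<close>).

  For \<open>m \<ge> 0\<close> the mode \<open>u(m)\<close> annihilates the vacuum on the right, so commuting it through
  \<open>Y(v\<^sub>1,y\<^sub>1) \<dots> Y(v\<^sub>n,y\<^sub>n) 1\<close> expresses \<open>\<langle>1, u(m) Y(v\<^sub>1,y\<^sub>1) \<dots> 1\<rangle>\<close> as
  \<open>\<Sum>k j. (m choose j) y\<^sub>k^(m-j) Z(\<dots>; u(j)v\<^sub>k,y\<^sub>k; \<dots>)\<close> (lemma \<open>vac_mode_mode_word\<close>). Summed against
  \<open>x^(-m-1)\<close> this gives the derivatives of \<open>1/(x-y\<^sub>k)\<close>, that is, the recursion with the kernel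
  \<open>1/(x-y)\<close>. For \<open>m = l \<le> 2N-2\<close> the same expression is zero, and it is exactly
  the factor by which \<open>f\<^sub>l(x)\<close> is multiplied on the right-hand side. So the
  contribution of each \<open>f\<^sub>l\<close> sums to zero. This proves the identity of formal series
  (lemma \<open>Z0_coeff_quasiprimary\<close>).

  The identity of rational functions needs in addition that the series converge to rational functions
  and that these are determined by their values in \<open>\<bar>y\<^sub>1\<bar> > \<dots> > \<bar>y\<^sub>n\<bar> > 0\<close>. The latter holds because
  a polynomial that vanishes there is zero. The former is proved by induction on \<open>n\<close> for arbitrary
  insertions (lemma \<open>Z0_expansion\<close>): the recursion with kernel \<open>1/(x-y)\<close>, with an extra term
  \<open>\<langle>1, u\<rangle> Z(v\<^sub>1,y\<^sub>1; \<dots>)\<close>, holds for every \<open>u\<close>, and multiplying an absolutely convergent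
  series in \<open>y\<close> by the negative binomial series for \<open>(x-y\<^sub>k)^(-j-1)\<close> preserves convergence in the
  domain. The vanishing for \<open>l \<le> 2N-2\<close> then passes from the
  coefficients to the rational functions (lemma \<open>Z0_identity\<close>).\<close>

section \<open>Polynomial functions\<close>

text \<open>Monomials may be indexed by any finite set, with repetitions: collecting equal exponents
  recovers the definition. This is what makes the closure under products short.\<close>

lemma polynomial_funI:
  assumes "finite I" and "\<And>i. i \<in> I \<Longrightarrow> length (e i) = n"
    and "\<And>ys. length ys = n \<Longrightarrow> P ys = (\<Sum>i\<in>I. c i * (\<Prod>k<n. (ys ! k) ^ (e i ! k)))"
  shows "polynomial_fun n P"
proof -
  let ?c = "\<lambda>as. \<Sum>i | i \<in> I \<and> e i = as. c i"
  have "P ys = (\<Sum>as\<in>e ` I. ?c as * (\<Prod>k<n. (ys ! k) ^ (as ! k)))" if "length ys = n" for ys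
    unfolding assms(3)[OF that]
    by (subst sum.image_gen[OF assms(1), of _ e]) (auto simp: sum_distrib_right intro!: sum.cong)
  then show ?thesis
    unfolding polynomial_fun_def using assms(1,2)
    by (intro exI[of _ "e ` I"] exI[of _ ?c]) auto
qed

lemma polynomial_funE:
  assumes "polynomial_fun n P"
  obtains A c where "finite A" "\<And>as. as \<in> A \<Longrightarrow> length as = n"
    "\<And>ys. length ys = n \<Longrightarrow> P ys = (\<Sum>as\<in>A. c as * (\<Prod>k<n. (ys ! k) ^ (as ! k)))"
  using assms unfolding polynomial_fun_def by blast

lemma polynomial_fun_cong:
  assumes "polynomial_fun n P" and "\<And>ys. length ys = n \<Longrightarrow> P ys = Q ys"
  shows "polynomial_fun n Q"
proof -
  obtain A c where A: "finite A" "\<And>as. as \<in> A \<Longrightarrow> length as = n"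
    "\<And>ys. length ys = n \<Longrightarrow> P ys = (\<Sum>as\<in>A. c as * (\<Prod>k<n. (ys ! k) ^ (as ! k)))"
    using assms(1) by (rule polynomial_funE) blast
  show ?thesis
    by (rule polynomial_funI[of A "\<lambda>as. as" _ _ c]) (simp_all add: A flip: assms(2))
qed

lemma polynomial_fun_const: "polynomial_fun n (\<lambda>_. c)"
  by (rule polynomial_funI[of "{()}" "\<lambda>_. replicate n 0" _ _ "\<lambda>_. c"]) auto

lemma polynomial_fun_nth:
  assumes "i < n"
  shows "polynomial_fun n (\<lambda>ys. ys ! i)"
proof (rule polynomial_funI[of "{()}" "\<lambda>_. (replicate n 0)[i := 1]" _ _ "\<lambda>_. 1"])
  fix ys :: "complex list" assume "length ys = n"
  have "(\<Prod>k<n. (ys ! k) ^ ((replicate n 0)[i := 1] ! k)) = (\<Prod>k<n. if k = i then ys ! k else 1)"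
    by (intro prod.cong) (auto simp: nth_list_update)
  also have "\<dots> = ys ! i" using assms by simp
  finally show "ys ! i = (\<Sum>_\<in>{()}. 1 * (\<Prod>k<n. (ys ! k) ^ ((replicate n 0)[i := 1] ! k)))"
    by simp
qed auto

lemma polynomial_fun_add:
  assumes "polynomial_fun n P" "polynomial_fun n Q"
  shows "polynomial_fun n (\<lambda>ys. P ys + Q ys)"
proof -
  obtain A c where A: "finite A" "\<And>as. as \<in> A \<Longrightarrow> length as = n"
    "\<And>ys. length ys = n \<Longrightarrow> P ys = (\<Sum>as\<in>A. c as * (\<Prod>k<n. (ys ! k) ^ (as ! k)))"
    using assms(1) by (rule polynomial_funE) blast
  obtain A' c' where A': "finite A'" "\<And>as. as \<in> A' \<Longrightarrow> length as = n"
    "\<And>ys. length ys = n \<Longrightarrow> Q ys = (\<Sum>as\<in>A'. c' as * (\<Prod>k<n. (ys ! k) ^ (as ! k)))"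
    using assms(2) by (rule polynomial_funE) blast
  show ?thesis
    by (rule polynomial_funI[of "A <+> A'" "case_sum id id" _ _ "case_sum c c'"])
       (auto simp: A A' sum.Plus)
qed

lemma polynomial_fun_mult:
  assumes "polynomial_fun n P" "polynomial_fun n Q"
  shows "polynomial_fun n (\<lambda>ys. P ys * Q ys)"
proof -
  obtain A c where A: "finite A" "\<And>as. as \<in> A \<Longrightarrow> length as = n"
    "\<And>ys. length ys = n \<Longrightarrow> P ys = (\<Sum>as\<in>A. c as * (\<Prod>k<n. (ys ! k) ^ (as ! k)))"
    using assms(1) by (rule polynomial_funE) blast
  obtain A' c' where A': "finite A'" "\<And>as. as \<in> A' \<Longrightarrow> length as = n"
    "\<And>ys. length ys = n \<Longrightarrow> Q ys = (\<Sum>as\<in>A'. c' as * (\<Prod>k<n. (ys ! k) ^ (as ! k)))"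
    using assms(2) by (rule polynomial_funE) blast
  show ?thesis
  proof (rule polynomial_funI[of "A \<times> A'" "\<lambda>(a, b). map2 (+) a b" _ _ "\<lambda>(a, b). c a * c' b"])
    fix ys :: "complex list" assume n: "length ys = n"
    show "P ys * Q ys = (\<Sum>i\<in>A \<times> A'. (case i of (a, b) \<Rightarrow> c a * c' b) *
            (\<Prod>k<n. ys ! k ^ ((case i of (a, b) \<Rightarrow> map2 (+) a b) ! k)))"
      unfolding A(3)[OF n] A'(3)[OF n] sum_product sum.cartesian_product
      using A(2) A'(2) by (intro sum.cong) (auto simp: power_add prod.distrib)
  qed (use A A' in auto)
qed

lemma polynomial_fun_sum:
  "(\<And>i. i \<in> I \<Longrightarrow> polynomial_fun n (P i)) \<Longrightarrow> polynomial_fun n (\<lambda>ys. \<Sum>i\<in>I. P i ys)"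
  by (induction I rule: infinite_finite_induct)
     (auto intro: polynomial_fun_const polynomial_fun_add polynomial_fun_mult)

lemma polynomial_fun_prod:
  "(\<And>i. i \<in> I \<Longrightarrow> polynomial_fun n (P i)) \<Longrightarrow> polynomial_fun n (\<lambda>ys. \<Prod>i\<in>I. P i ys)"
  by (induction I rule: infinite_finite_induct)
     (auto intro: polynomial_fun_const polynomial_fun_add polynomial_fun_mult)

lemma polynomial_fun_power:
  "polynomial_fun n P \<Longrightarrow> polynomial_fun n (\<lambda>ys. P ys ^ b)"
  by (induction b) (auto intro: polynomial_fun_const polynomial_fun_mult)

lemma polynomial_fun_diff:
  assumes "polynomial_fun n P" "polynomial_fun n Q"
  shows "polynomial_fun n (\<lambda>ys. P ys - Q ys)"
proof -
  have "polynomial_fun n (\<lambda>ys. P ys + (-1) * Q ys)" using assms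
    by (intro polynomial_fun_add polynomial_fun_mult polynomial_fun_const)
  then show ?thesis by simp
qed

lemma polynomial_fun_tl:
  assumes "polynomial_fun n P"
  shows "polynomial_fun (Suc n) (\<lambda>ys. P (tl ys))"
proof -
  obtain A c where A: "finite A" "\<And>as. as \<in> A \<Longrightarrow> length as = n"
    "\<And>ys. length ys = n \<Longrightarrow> P ys = (\<Sum>as\<in>A. c as * (\<Prod>k<n. (ys ! k) ^ (as ! k)))"
    using assms(1) by (rule polynomial_funE) blast
  show ?thesis
    by (rule polynomial_funI[of A "\<lambda>as. 0 # as" _ _ c])
       (use A in \<open>auto simp: nth_tl prod.lessThan_Suc_shift simp del: prod.lessThan_Suc\<close>)
qed

lemma polynomial_fun_slices:
  assumes "polynomial_fun (Suc n) P"
  shows "polynomial_fun n (\<lambda>ys. P (x # ys))"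
    and "length ys = n \<Longrightarrow> \<exists>p. \<forall>x. P (x # ys) = poly p x"
proof -
  obtain A c where A: "finite A" "\<And>as. as \<in> A \<Longrightarrow> length as = Suc n"
    "\<And>ys. length ys = Suc n \<Longrightarrow> P ys = (\<Sum>as\<in>A. c as * (\<Prod>k<Suc n. (ys ! k) ^ (as ! k)))"
    using assms(1) by (rule polynomial_funE) blast
  have P: "P (x # ys) = (\<Sum>as\<in>A. c as * (x ^ (as ! 0) * (\<Prod>k<n. (ys ! k) ^ (as ! Suc k))))"
    if "length ys = n" for x ys
    using that A(3)[of "x # ys"]
    by (simp add: prod.lessThan_Suc_shift del: prod.lessThan_Suc)
  have "polynomial_fun n (\<lambda>ys. \<Sum>as\<in>A. c as * (x ^ (as ! 0) * (\<Prod>k<n. (ys ! k) ^ (as ! Suc k))))"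
    by (intro polynomial_fun_sum polynomial_fun_mult polynomial_fun_const polynomial_fun_prod
          polynomial_fun_power polynomial_fun_nth) auto
  then show "polynomial_fun n (\<lambda>ys. P (x # ys))"
    by (rule polynomial_fun_cong) (simp add: P)
  show "\<exists>p. \<forall>x. P (x # ys) = poly p x" if "length ys = n"
    by (rule exI[of _ "\<Sum>as\<in>A. monom (c as * (\<Prod>k<n. (ys ! k) ^ (as ! Suc k))) (as ! 0)"])
       (simp add: P[OF that] poly_sum poly_monom mult_ac)
qed

definition expansion_domain :: "nat \<Rightarrow> complex list set" where
  "expansion_domain n =
     {ys. length ys = n \<and> sorted_wrt (\<lambda>a b. cmod a > cmod b) ys \<and> 0 \<notin> set ys}"

lemma expansion_domain_Cons:
  "x # ys \<in> expansion_domain (Suc n) \<longleftrightarrow>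
     ys \<in> expansion_domain n \<and> x \<noteq> 0 \<and> (\<forall>y\<in>set ys. cmod y < cmod x)"
  by (auto simp: expansion_domain_def)

lemma expansion_domain_length: "ys \<in> expansion_domain n \<Longrightarrow> length ys = n"
  by (simp add: expansion_domain_def)

lemma expansion_domain_distinct: "ys \<in> expansion_domain n \<Longrightarrow> distinct ys"
proof (induction ys arbitrary: n)
  case (Cons x ys)
  then show ?case by (cases n) (auto simp: expansion_domain_Cons expansion_domain_def)
qed simp

text \<open>The variables are freed one at a time. For a fixed tail in the domain, the univariate
  polynomial in the first variable has infinitely many zeros, since every \<open>x\<close> with \<open>\<bar>x\<bar>\<close> large is
  admissible; hence it is zero for all \<open>x\<close>, and for each \<open>x\<close> the induction hypothesis applies to
  the remaining variables.\<close>

lemma polynomial_fun_eq_zero: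
  assumes "polynomial_fun n P" and "\<And>ys. ys \<in> expansion_domain n \<Longrightarrow> P ys = 0"
    and "length ys = n"
  shows "P ys = 0"
  using assms
proof (induction n arbitrary: P ys)
  case 0
  then show ?case by (simp add: expansion_domain_def)
next
  case (Suc n)
  have tail: "P (x # zs) = 0" if zs: "zs \<in> expansion_domain n" for x zs
  proof -
    obtain p where p: "\<And>x. P (x # zs) = poly p x"
      using polynomial_fun_slices(2)[OF Suc.prems(1)] expansion_domain_length[OF zs] by blast
    define r where "r = Max (insert 0 (cmod ` set zs))"
    have r: "0 \<le> r" "\<And>y. y \<in> set zs \<Longrightarrow> cmod y \<le> r"
      unfolding r_def by (auto intro: Max_ge)
    have "of_nat ` {k. r < real k} \<subseteq> {x. poly p x = 0}"
    proof clarify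
      fix k assume "r < real k"
      then have "of_nat k # zs \<in> expansion_domain (Suc n)"
        using r zs by (force simp: expansion_domain_Cons)
      then show "poly p (of_nat k) = 0" using Suc.prems(2) p by metis
    qed
    moreover have "infinite {k. r < real k}"
      unfolding infinite_nat_iff_unbounded by (metis mem_Collect_eq reals_Archimedean2 less_trans
          of_nat_less_iff linorder_neqE_nat not_less_iff_gr_or_eq)
    then have "infinite (of_nat ` {k. r < real k} :: complex set)"
      by (simp add: finite_image_iff inj_on_def)
    ultimately have "p = 0" using poly_roots_finite infinite_super by blast
    then show ?thesis using p by simp
  qed
  \<comment> \<open>By \<open>tail\<close>, each slice \<open>P (x # _)\<close> vanishes on the smaller domain.\<close>
  obtain x zs where ys: "ys = x # zs" "length zs = n"
    using Suc.prems(3) by (cases ys) auto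
  show ?case
    unfolding ys(1)
    by (rule Suc.IH[of "\<lambda>zs. P (x # zs)"])
       (use polynomial_fun_slices(1)[OF Suc.prems(1)] tail ys(2) in auto)
qed

section \<open>Rational functions with poles along the diagonals\<close>

definition diagonal_prod :: "nat \<Rightarrow> complex list \<Rightarrow> complex" where
  "diagonal_prod n ys = (\<Prod>j<n. \<Prod>i<j. (ys ! i - ys ! j))"

text \<open>Unlike \<open>rational_on_config\<close>, this leaves the values outside the configuration space
  unconstrained and has no division, which makes it closed under the usual formation of terms.\<close>

definition rational_fun :: "nat \<Rightarrow> (complex list \<Rightarrow> complex) \<Rightarrow> bool" where
  "rational_fun n F \<longleftrightarrow> (\<exists>P b. polynomial_fun n P \<and>
     (\<forall>ys. length ys = n \<and> distinct ys \<longrightarrow> F ys * diagonal_prod n ys ^ b = P ys))"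

lemma polynomial_fun_diagonal_prod: "polynomial_fun n (diagonal_prod n)"
  unfolding diagonal_prod_def
  by (intro polynomial_fun_prod polynomial_fun_diff polynomial_fun_nth) auto

lemma diagonal_prod_nonzero: "length ys = n \<Longrightarrow> distinct ys \<Longrightarrow> diagonal_prod n ys \<noteq> 0"
  by (auto simp: diagonal_prod_def nth_eq_iff_index_eq)

lemma diagonal_prod_Cons:
  assumes "length ys = n"
  shows "diagonal_prod (Suc n) (x # ys) = (\<Prod>k<n. x - ys ! k) * diagonal_prod n ys"
  unfolding diagonal_prod_def
  by (simp add: prod.lessThan_Suc_shift prod.distrib del: prod.lessThan_Suc)

lemma rational_funE:
  assumes "rational_fun n F"
  obtains P b where "polynomial_fun n P"
    "\<And>ys. length ys = n \<Longrightarrow> distinct ys \<Longrightarrow> F ys * diagonal_prod n ys ^ b = P ys"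
  using assms unfolding rational_fun_def by blast

lemma rational_on_config_iff:
  "rational_on_config n R \<longleftrightarrow>
     rational_fun n R \<and> (\<forall>ys. \<not> (length ys = n \<and> distinct ys) \<longrightarrow> R ys = 0)"
proof -
  have "(\<forall>ys. R ys = (if length ys = n \<and> distinct ys
        then P ys / (\<Prod>j<n. \<Prod>i<j. (ys ! i - ys ! j) ^ b) else 0)) \<longleftrightarrow>
      (\<forall>ys. length ys = n \<and> distinct ys \<longrightarrow> R ys * diagonal_prod n ys ^ b = P ys) \<and>
      (\<forall>ys. \<not> (length ys = n \<and> distinct ys) \<longrightarrow> R ys = 0)" for P b
  proof -
    have "(\<Prod>j<n. \<Prod>i<j. (ys ! i - ys ! j) ^ b) = diagonal_prod n ys ^ b" for ys
      by (simp add: diagonal_prod_def prod_power_distrib)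
    then show ?thesis using diagonal_prod_nonzero by (auto simp: field_simps)
  qed
  note eq = this
  show ?thesis unfolding rational_on_config_def rational_fun_def eq by blast
qed

lemma rational_fun_cong:
  assumes "rational_fun n F" and "\<And>ys. length ys = n \<Longrightarrow> distinct ys \<Longrightarrow> F ys = G ys"
  shows "rational_fun n G"
proof -
  obtain P b where P: "polynomial_fun n P"
    "\<And>ys. length ys = n \<Longrightarrow> distinct ys \<Longrightarrow> F ys * diagonal_prod n ys ^ b = P ys"
    using assms(1) by (rule rational_funE) blast
  then show ?thesis unfolding rational_fun_def
    by (intro exI[of _ P] exI[of _ b]) (simp flip: assms(2))
qed

lemma rational_fun_polynomial: "polynomial_fun n P \<Longrightarrow> rational_fun n P"
  unfolding rational_fun_def by (intro exI[of _ P] exI[of _ 0]) auto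

lemma rational_fun_add:
  assumes "rational_fun n F" "rational_fun n G"
  shows "rational_fun n (\<lambda>ys. F ys + G ys)"
proof -
  obtain P b where P: "polynomial_fun n P"
    "\<And>ys. length ys = n \<Longrightarrow> distinct ys \<Longrightarrow> F ys * diagonal_prod n ys ^ b = P ys"
    using assms(1) by (rule rational_funE) blast
  obtain Q c where Q: "polynomial_fun n Q"
    "\<And>ys. length ys = n \<Longrightarrow> distinct ys \<Longrightarrow> G ys * diagonal_prod n ys ^ c = Q ys"
    using assms(2) by (rule rational_funE) blast
  show ?thesis unfolding rational_fun_def
  proof (intro exI[of _ "\<lambda>ys. P ys * diagonal_prod n ys ^ c + Q ys * diagonal_prod n ys ^ b"]
      exI[of _ "b + c"] conjI allI impI)
    show "polynomial_fun n (\<lambda>ys. P ys * diagonal_prod n ys ^ c + Q ys * diagonal_prod n ys ^ b)"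
      using P(1) Q(1) by (intro polynomial_fun_add polynomial_fun_mult polynomial_fun_power
        polynomial_fun_diagonal_prod)
    fix ys :: "complex list" assume "length ys = n \<and> distinct ys"
    then show "(F ys + G ys) * diagonal_prod n ys ^ (b + c) =
        P ys * diagonal_prod n ys ^ c + Q ys * diagonal_prod n ys ^ b"
      by (simp add: power_add ring_distribs mult_ac flip: P(2) Q(2))
  qed
qed

lemma rational_fun_mult:
  assumes "rational_fun n F" "rational_fun n G"
  shows "rational_fun n (\<lambda>ys. F ys * G ys)"
proof -
  obtain P b where P: "polynomial_fun n P"
    "\<And>ys. length ys = n \<Longrightarrow> distinct ys \<Longrightarrow> F ys * diagonal_prod n ys ^ b = P ys"
    using assms(1) by (rule rational_funE) blast
  obtain Q c where Q: "polynomial_fun n Q"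
    "\<And>ys. length ys = n \<Longrightarrow> distinct ys \<Longrightarrow> G ys * diagonal_prod n ys ^ c = Q ys"
    using assms(2) by (rule rational_funE) blast
  show ?thesis unfolding rational_fun_def
  proof (intro exI[of _ "\<lambda>ys. P ys * Q ys"] exI[of _ "b + c"] conjI allI impI)
    show "polynomial_fun n (\<lambda>ys. P ys * Q ys)" using P(1) Q(1) by (rule polynomial_fun_mult)
    fix ys :: "complex list" assume "length ys = n \<and> distinct ys"
    then show "F ys * G ys * diagonal_prod n ys ^ (b + c) = P ys * Q ys"
      by (simp add: power_add mult_ac flip: P(2) Q(2))
  qed
qed

lemma rational_fun_sum:
  "(\<And>i. i \<in> I \<Longrightarrow> rational_fun n (F i)) \<Longrightarrow> rational_fun n (\<lambda>ys. \<Sum>i\<in>I. F i ys)"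
  by (induction I rule: infinite_finite_induct)
     (auto intro: rational_fun_add rational_fun_polynomial polynomial_fun_const)

lemma rational_fun_power:
  "rational_fun n F \<Longrightarrow> rational_fun n (\<lambda>ys. F ys ^ b)"
  by (induction b) (auto intro: rational_fun_mult rational_fun_polynomial polynomial_fun_const)

lemma rational_fun_tl:
  assumes "rational_fun n F"
  shows "rational_fun (Suc n) (\<lambda>ys. F (tl ys))"
proof -
  obtain P b where P: "polynomial_fun n P"
    "\<And>ys. length ys = n \<Longrightarrow> distinct ys \<Longrightarrow> F ys * diagonal_prod n ys ^ b = P ys"
    using assms(1) by (rule rational_funE) blast
  show ?thesis unfolding rational_fun_def
  proof (intro exI[of _ "\<lambda>ys. P (tl ys) * (\<Prod>k<n. ys ! 0 - ys ! Suc k) ^ b"]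
      exI[of _ b] conjI allI impI)
    show "polynomial_fun (Suc n) (\<lambda>ys. P (tl ys) * (\<Prod>k<n. ys ! 0 - ys ! Suc k) ^ b)"
      using P(1) by (intro polynomial_fun_mult polynomial_fun_tl polynomial_fun_power
        polynomial_fun_prod polynomial_fun_diff polynomial_fun_nth) auto
    fix ys :: "complex list" assume ys: "length ys = Suc n \<and> distinct ys"
    then obtain x zs where "ys = x # zs" by (cases ys) auto
    then show "F (tl ys) * diagonal_prod (Suc n) ys ^ b =
        P (tl ys) * (\<Prod>k<n. ys ! 0 - ys ! Suc k) ^ b"
      using ys by (simp add: diagonal_prod_Cons power_mult_distrib mult_ac flip: P(2))
  qed
qed

lemma rational_fun_pole:
  assumes "k < n"
  shows "rational_fun (Suc n) (\<lambda>ys. 1 / (hd ys - tl ys ! k))"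
  unfolding rational_fun_def
proof (intro exI[of _ "\<lambda>ys. (\<Prod>i\<in>{..<n} - {k}. ys ! 0 - ys ! Suc i) * diagonal_prod n (tl ys)"]
      exI[of _ 1] conjI allI impI)
  show "polynomial_fun (Suc n)
      (\<lambda>ys. (\<Prod>i\<in>{..<n} - {k}. ys ! 0 - ys ! Suc i) * diagonal_prod n (tl ys))"
    by (intro polynomial_fun_mult polynomial_fun_tl polynomial_fun_diagonal_prod
        polynomial_fun_prod polynomial_fun_diff polynomial_fun_nth) auto
  fix ys :: "complex list" assume ys: "length ys = Suc n \<and> distinct ys"
  then obtain x zs where ys': "ys = x # zs" by (cases ys) auto
  have "(\<Prod>i<n. x - zs ! i) = (x - zs ! k) * (\<Prod>i\<in>{..<n} - {k}. x - zs ! i)"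
    using assms by (subst prod.remove[of _ k]) auto
  moreover have "x - zs ! k \<noteq> 0" using ys ys' assms by auto
  ultimately show "1 / (hd ys - tl ys ! k) * diagonal_prod (Suc n) ys ^ 1 =
      (\<Prod>i\<in>{..<n} - {k}. ys ! 0 - ys ! Suc i) * diagonal_prod n (tl ys)"
    using ys ys' by (simp add: diagonal_prod_Cons)
qed

lemma rational_fun_eq:
  assumes "rational_fun n F" "rational_fun n G"
    and "\<And>ys. ys \<in> expansion_domain n \<Longrightarrow> F ys = G ys"
    and "length ys = n" "distinct ys"
  shows "F ys = G ys"
proof -
  have "rational_fun n (\<lambda>ys. F ys + (\<lambda>_. -1) ys * G ys)"
    using assms(1,2)
    by (intro rational_fun_add rational_fun_mult rational_fun_polynomial[OF polynomial_fun_const])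
  then have "rational_fun n (\<lambda>ys. F ys - G ys)" by simp
  then obtain P b where P: "polynomial_fun n P"
    "\<And>ys. length ys = n \<Longrightarrow> distinct ys \<Longrightarrow> (F ys - G ys) * diagonal_prod n ys ^ b = P ys"
    by (rule rational_funE) blast
  have "P ys = 0"
    using P(1)
  proof (rule polynomial_fun_eq_zero)
    fix zs assume "zs \<in> expansion_domain n"
    then show "P zs = 0"
      using P(2)[of zs] assms(3) expansion_domain_length expansion_domain_distinct by force
  qed (rule assms)
  then show ?thesis
    using P(2)[OF assms(4,5)] diagonal_prod_nonzero[OF assms(4,5)] by simp
qed

section \<open>Series expansions of rational functions\<close>

text \<open>\<open>S\<close> collects the coefficients of a formal series in \<open>n\<close> variables. Convergence is unconditional,
  hence absolute, which allows series to be multiplied and reindexed below.\<close>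

definition expands_as ::
    "nat \<Rightarrow> (int list \<Rightarrow> complex) \<Rightarrow> (complex list \<Rightarrow> complex) \<Rightarrow> bool" where
  "expands_as n S F \<longleftrightarrow> (\<forall>ys\<in>expansion_domain n.
     ((\<lambda>es. S es * (\<Prod>i<n. (ys ! i) powi (es ! i))) has_sum F ys) {es. length es = n})"

lemma expands_asD:
  "expands_as n S F \<Longrightarrow> ys \<in> expansion_domain n \<Longrightarrow>
     ((\<lambda>es. S es * (\<Prod>i<n. (ys ! i) powi (es ! i))) has_sum F ys) {es. length es = n}"
  by (simp add: expands_as_def)

lemma expands_as_cong:
  assumes "expands_as n S F" and "\<And>es. length es = n \<Longrightarrow> S es = T es"
    and "\<And>ys. ys \<in> expansion_domain n \<Longrightarrow> F ys = G ys"
  shows "expands_as n T G"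
  unfolding expands_as_def
proof
  fix ys assume ys: "ys \<in> expansion_domain n"
  show "((\<lambda>es. T es * (\<Prod>i<n. (ys ! i) powi (es ! i))) has_sum G ys) {es. length es = n}"
    using expands_asD[OF assms(1) ys] unfolding assms(3)[OF ys]
    by (rule has_sum_cong[THEN iffD1, rotated]) (simp add: assms(2))
qed

lemma expands_as_zero: "expands_as n (\<lambda>_. 0) (\<lambda>_. 0)"
  by (simp add: expands_as_def)

lemma expands_as_add:
  "expands_as n S F \<Longrightarrow> expands_as n T G \<Longrightarrow>
     expands_as n (\<lambda>es. S es + T es) (\<lambda>ys. F ys + G ys)"
  by (simp add: expands_as_def has_sum_add ring_distribs)

lemma expands_as_cmult:
  assumes "expands_as n S F"
  shows "expands_as n (\<lambda>es. c * S es) (\<lambda>ys. c * F ys)"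
  using assms by (simp add: expands_as_def has_sum_cmult_right mult.assoc)

lemma expands_as_sum:
  "(\<And>i. i \<in> I \<Longrightarrow> expands_as n (S i) (F i)) \<Longrightarrow>
     expands_as n (\<lambda>es. \<Sum>i\<in>I. S i es) (\<lambda>ys. \<Sum>i\<in>I. F i ys)"
  by (induction I rule: infinite_finite_induct) (auto intro: expands_as_zero expands_as_add)

lemma expands_as_unique:
  assumes "expands_as n S F" "expands_as n S G" "rational_fun n F" "rational_fun n G"
    and "length ys = n" "distinct ys"
  shows "F ys = G ys"
  using assms(3,4) _ assms(5,6)
proof (rule rational_fun_eq)
  show "F zs = G zs" if "zs \<in> expansion_domain n" for zs
    by (rule has_sum_unique[OF expands_asD[OF assms(1) that] expands_asD[OF assms(2) that]])
qed

lemma Z0_eq: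
  assumes "expands_as (length vs) (Z0_coeff V B vs) F" "rational_fun (length vs) F"
    and "length ys = length vs" "distinct ys"
  shows "Z0 V B vs ys = F ys"
proof -
  define R where "R = (\<lambda>ys. if length ys = length vs \<and> distinct ys then F ys else 0)"
  have Z0: "Z0 V B vs = (THE R. rational_on_config (length vs) R \<and>
      expands_as (length vs) (Z0_coeff V B vs) R)"
    unfolding Z0_def expands_as_def expansion_domain_def Ball_def mem_Collect_eq ..
  have R: "rational_fun (length vs) R" "expands_as (length vs) (Z0_coeff V B vs) R"
    by (rule rational_fun_cong[OF assms(2)], simp add: R_def)
       (rule expands_as_cong[OF assms(1)],
        simp_all add: R_def expansion_domain_length expansion_domain_distinct)
  have "Z0 V B vs = R"
    unfolding Z0
  proof (rule the_equality)
    show "rational_on_config (length vs) R \<and> expands_as (length vs) (Z0_coeff V B vs) R"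
      using R by (auto simp: rational_on_config_iff R_def)
    fix R' assume R': "rational_on_config (length vs) R' \<and> expands_as (length vs) (Z0_coeff V B vs) R'"
    show "R' = R"
    proof
      fix ys
      show "R' ys = R ys"
      proof (cases "length ys = length vs \<and> distinct ys")
        case True
        then show ?thesis
          using expands_as_unique[of _ _ R' R] R R' by (auto simp: rational_on_config_iff)
      next
        case False
        then show ?thesis using R' by (auto simp: rational_on_config_iff R_def)
      qed
    qed
  qed
  then show ?thesis using assms by (simp add: R_def)
qed

lemma prod_powi_update:
  fixes ys :: "complex list"
  assumes "k < n" "length es = n" "ys ! k \<noteq> 0"
  shows "(\<Prod>i<n. (ys ! i) powi (es[k := es ! k + d] ! i)) =
    (ys ! k) powi d * (\<Prod>i<n. (ys ! i) powi (es ! i))"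
proof -
  have "(\<Prod>i<n. (ys ! i) powi (es[k := es ! k + d] ! i)) =
      (ys ! k) powi (es ! k + d) * (\<Prod>i\<in>{..<n} - {k}. (ys ! i) powi (es ! i))"
    using assms by (subst prod.remove[of _ k]) (auto intro!: prod.cong)
  also have "\<dots> = (ys ! k) powi d * (\<Prod>i<n. (ys ! i) powi (es ! i))"
    using assms by (subst (2) prod.remove[of _ k]) (auto simp: power_int_add)
  finally show ?thesis .
qed

lemma expansion_domain_nth: "ys \<in> expansion_domain n \<Longrightarrow> k < n \<Longrightarrow> ys ! k \<noteq> 0"
  using nth_mem[of k ys] by (auto simp: expansion_domain_def simp del: nth_mem)

text \<open>Multiplication of a series by \<open>y\<^sub>k^d\<close>.\<close>

lemma expands_as_shift:
  assumes "expands_as n S F" "k < n"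
  shows "expands_as n (\<lambda>es. S (es[k := es ! k - d])) (\<lambda>ys. (ys ! k) powi d * F ys)"
  unfolding expands_as_def
proof
  fix ys assume ys: "ys \<in> expansion_domain n"
  let ?m = "\<lambda>es. \<Prod>i<n. (ys ! i) powi (es ! i)"
  note nz = expansion_domain_nth[OF ys assms(2)]
  have "((\<lambda>es. (ys ! k) powi d * (S es * ?m es)) has_sum (ys ! k) powi d * F ys) {es. length es = n}"
    by (rule has_sum_cmult_right[OF expands_asD[OF assms(1) ys]])
  also have "?this \<longleftrightarrow> ((\<lambda>es. S (es[k := es ! k - d]) * ?m es) has_sum (ys ! k) powi d * F ys)
      {es. length es = n}"
    by (rule has_sum_reindex_bij_witness[where i = "\<lambda>es. es[k := es ! k - d]" and
        j = "\<lambda>es. es[k := es ! k + d]"])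
       (use assms(2) nz in \<open>auto simp: prod_powi_update\<close>)
  finally show "((\<lambda>es. S (es[k := es ! k - d]) * ?m es) has_sum (ys ! k) powi d * F ys)
      {es. length es = n}" .
qed

lemma has_sum_product_complex:
  fixes f :: "'a \<Rightarrow> complex" and g :: "'b \<Rightarrow> complex"
  assumes "(f has_sum F) A" "(g has_sum G) B"
  shows "((\<lambda>(a, b). f a * g b) has_sum F * G) (A \<times> B)"
proof (rule has_sum_SigmaI)
  show "((\<lambda>b. case (a, b) of (a, b) \<Rightarrow> f a * g b) has_sum f a * G) B" for a
    using has_sum_cmult_right[OF assms(2)] by simp
  show "((\<lambda>a. f a * G) has_sum F * G) A"
    by (rule has_sum_cmult_left[OF assms(1)])
  have abs: "(\<lambda>a. norm (f a)) summable_on A" "(\<lambda>b. norm (g b)) summable_on B"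
    using assms by (auto simp: has_sum_imp_summable simp flip: summable_on_iff_abs_summable_on_complex)
  have "(\<lambda>p. norm (case p of (a, b) \<Rightarrow> f a * g b)) summable_on A \<times> B"
    unfolding Infinite_Sum.abs_summable_on_Sigma_iff
    using abs by (auto simp: norm_mult abs_mult infsum_nonneg infsum_cmult_right' summable_on_cmult_right
      intro!: summable_on_cmult_left)
  then show "(\<lambda>(a, b). f a * g b) summable_on A \<times> B"
    by (rule abs_summable_summable)
qed

text \<open>The binomial series with exponent \<open>-(j+1)\<close>, whose coefficients are \<open>((b+j) choose j)\<close> after the
  signs cancel.\<close>

lemma has_sum_negative_binomial:
  fixes z :: complex
  assumes "norm z < 1"
  shows "((\<lambda>b. of_nat ((b + j) choose j) * z ^ b) has_sum 1 / (1 - z) ^ Suc j) UNIV"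
proof -
  have coeff: "(- of_nat (Suc j) gchoose b) * (- w) ^ b = of_nat ((b + j) choose j) * w ^ b"
    for b and w :: complex
  proof -
    have "(- of_nat (Suc j) gchoose b :: complex) = (-1) ^ b * (of_nat (j + b) gchoose b)"
      by (subst gbinomial_minus) (simp add: add_ac)
    also have "(of_nat (j + b) gchoose b :: complex) = of_nat ((b + j) choose j)"
      using binomial_symmetric[of j "b + j"] by (simp only: binomial_gbinomial add.commute) simp
    finally have "(- of_nat (Suc j) gchoose b) * (- w) ^ b =
        of_nat ((b + j) choose j) * ((-1) ^ b * (- w) ^ b)"
      by (simp only: mult_ac)
    also have "(-1) ^ b * (- w) ^ b = w ^ b"
      by (simp flip: power_mult_distrib)
    finally show ?thesis .
  qed
  have sums: "(\<lambda>b. of_nat ((b + j) choose j) * w ^ b) sums (1 / (1 - w) ^ Suc j)"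
    if "norm w < 1" for w :: complex
  proof -
    have "1 - w \<noteq> 0" using that by auto
    then have "(1 - w) powr of_nat (Suc j) = (1 - w) ^ Suc j"
      by (intro powr_nat') simp
    then have "(1 + - w) powr (- of_nat (Suc j)) = 1 / (1 - w) ^ Suc j"
      by (simp only: powr_minus add_uminus_conv_diff inverse_eq_divide)
    then show ?thesis
      using gen_binomial_complex[of "- w" "- of_nat (Suc j)"] that by (simp only: coeff) simp
  qed
  have "summable (\<lambda>b. complex_of_real (real ((b + j) choose j) * norm z ^ b))"
    using sums_summable[OF sums[of "of_real (norm z)"]] assms by simp
  then have "summable (\<lambda>b. norm (of_nat ((b + j) choose j) * z ^ b))"
    unfolding summable_complex_of_real by (simp add: norm_mult norm_power)
  then show ?thesis
    by (rule norm_summable_imp_has_sum[OF _ sums[OF assms]])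
qed

lemma has_sum_pole:
  fixes x y :: complex
  assumes "norm y < norm x"
  shows "((\<lambda>b. of_nat ((b + j) choose j) * y ^ b * x powi (- int (b + j) - 1))
    has_sum 1 / (x - y) ^ Suc j) UNIV"
proof -
  have x: "x \<noteq> 0" using assms by auto
  have "norm (y / x) < 1" using assms x by (simp add: norm_divide)
  from has_sum_cmult_right[OF has_sum_negative_binomial[OF this], of "1 / x ^ Suc j" j]
  have "((\<lambda>b. 1 / x ^ Suc j * (of_nat ((b + j) choose j) * (y / x) ^ b))
    has_sum 1 / x ^ Suc j * (1 / (1 - y / x) ^ Suc j)) UNIV" .
  moreover have "1 / x ^ Suc j * (1 / (1 - y / x) ^ Suc j) = 1 / (x - y) ^ Suc j"
    using x by (simp add: right_diff_distrib flip: power_mult_distrib power_Suc)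
  moreover have "1 / x ^ Suc j * (of_nat ((b + j) choose j) * (y / x) ^ b) =
      of_nat ((b + j) choose j) * y ^ b * x powi (- int (b + j) - 1)" for b
  proof -
    have "- int (b + j) - 1 = - int (Suc j + b)" by simp
    then have "x powi (- int (b + j) - 1) = 1 / (x ^ Suc j * x ^ b)"
      by (simp only: power_int_minus power_int_of_nat power_add inverse_eq_divide)
    then show ?thesis by (simp add: power_divide)
  qed
  ultimately show ?thesis by simp
qed

text \<open>The coefficient of \<open>x^a\<close> in \<open>(x-y\<^sub>k)^(-j-1)\<close> is \<open>(m choose j) y\<^sub>k^(m-j)\<close> with \<open>m = -a-1 \<ge> 0\<close>, and
  multiplying by \<open>y\<^sub>k^(m-j)\<close> shifts the \<open>k\<close>-th exponent. The result is the coefficient that the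
  commutator formula produces.\<close>

lemma expands_as_pole:
  assumes "expands_as n S F" "k < n"
  shows "expands_as (Suc n)
    (\<lambda>es. if hd es < 0 then of_nat (nat (- hd es - 1) choose j) *
        S ((tl es)[k := tl es ! k - (- hd es - 1 - int j)]) else 0)
    (\<lambda>ys. F (tl ys) * (1 / (hd ys - tl ys ! k)) ^ Suc j)"
  (is "expands_as _ ?T _")
  unfolding expands_as_def
proof
  fix xs assume xs: "xs \<in> expansion_domain (Suc n)"
  then obtain x ys where xs_eq: "xs = x # ys"
    by (cases xs) (auto simp: expansion_domain_def)
  have ys: "ys \<in> expansion_domain n" and lt: "\<And>y. y \<in> set ys \<Longrightarrow> norm y < norm x"
    using xs by (auto simp: xs_eq expansion_domain_Cons)
  note nz = expansion_domain_nth[OF ys assms(2)]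
  let ?m = "\<lambda>es. \<Prod>i<n. (ys ! i) powi (es ! i)"
  \<comment> \<open>The pair of the term \<open>y\<^sub>k^b x^(-b-j-1)\<close> of the pole and the monomial \<open>es\<close> of the series
    contributes to the monomial \<open>?g (b, es)\<close> of the product.\<close>
  let ?g = "\<lambda>(b, es). (- int (b + j) - 1) # es[k := es ! k + int b]"
  have inj: "inj_on ?g (UNIV \<times> {es. length es = n})"
  proof (rule inj_onI)
    fix p q assume p: "p \<in> UNIV \<times> {es. length es = n}" and q: "q \<in> UNIV \<times> {es. length es = n}"
      and pq: "?g p = ?g q"
    obtain b es c es' where eqs: "p = (b, es)" "q = (c, es')" by fastforce
    have bc: "b = c" and eq: "es[k := es ! k + int b] = es'[k := es' ! k + int b]"
      using pq by (auto simp: eqs)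
    have "es = es'"
    proof (rule nth_equalityI)
      fix i assume "i < length es"
      then show "es ! i = es' ! i"
        using arg_cong[OF eq, of "\<lambda>l. l ! i"] p q assms(2) by (cases "i = k") (auto simp: eqs)
    qed (use p q in \<open>simp add: eqs\<close>)
    then show "p = q" by (simp add: eqs bc)
  qed
  have "norm (ys ! k) < norm x"
    using lt assms(2) expansion_domain_length[OF ys] by simp
  then have "((\<lambda>(b, es). (of_nat ((b + j) choose j) * (ys ! k) ^ b * x powi (- int (b + j) - 1)) *
      (S es * ?m es)) has_sum 1 / (x - ys ! k) ^ Suc j * F ys) (UNIV \<times> {es. length es = n})"
    by (intro has_sum_product_complex has_sum_pole expands_asD[OF assms(1) ys])
  also have "?this \<longleftrightarrow> ((\<lambda>es. ?T es * (\<Prod>i<Suc n. (xs ! i) powi (es ! i)))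
      has_sum 1 / (x - ys ! k) ^ Suc j * F ys) (?g ` (UNIV \<times> {es. length es = n}))"
    unfolding has_sum_reindex[OF inj]
  proof (rule has_sum_cong)
    fix p :: "nat \<times> int list" assume "p \<in> UNIV \<times> {es. length es = n}"
    then obtain b es where p: "p = (b, es)" and "length es = n" by blast
    moreover have "nat (- (- int (b + j) - 1) - 1) = b + j" by simp
    ultimately show "(case p of (b, es) \<Rightarrow>
          of_nat ((b + j) choose j) * (ys ! k) ^ b * x powi (- int (b + j) - 1) * (S es * ?m es)) =
        ((\<lambda>es. ?T es * (\<Prod>i<Suc n. (xs ! i) powi (es ! i))) \<circ> ?g) p"
      using assms(2) nz
      by (simp add: xs_eq prod.lessThan_Suc_shift prod_powi_update power_int_of_nat mult_ac
          del: prod.lessThan_Suc)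
  qed
  also have "\<dots> \<longleftrightarrow> ((\<lambda>es. ?T es * (\<Prod>i<Suc n. (xs ! i) powi (es ! i)))
      has_sum 1 / (x - ys ! k) ^ Suc j * F ys) {es. length es = Suc n}"
  proof (rule has_sum_cong_neutral)
    fix es assume es: "es \<in> {es. length es = Suc n} - ?g ` (UNIV \<times> {es. length es = n})"
    then obtain a es' where es': "es = a # es'" "length es' = n" by (cases es) auto
    \<comment> \<open>For \<open>0 \<le> -a-1 < j\<close> the coefficient is zero because the binomial coefficient is.\<close>
    have "\<not> (a < 0 \<and> nat (- a - 1) \<ge> j)"
    proof
      assume a: "a < 0 \<and> nat (- a - 1) \<ge> j"
      define b where "b = nat (- a - 1) - j"
      have "a = - int (b + j) - 1" using a by (simp add: b_def of_nat_diff)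
      then have "es = ?g (b, es'[k := es' ! k - int b])"
        using es' assms(2) by simp
      then have "es \<in> ?g ` (UNIV \<times> {es. length es = n})"
        by (rule image_eqI) (simp add: es')
      then show False using es by blast
    qed
    then show "?T es * (\<Prod>i<Suc n. (xs ! i) powi (es ! i)) = 0"
      by (auto simp: es' binomial_eq_0)
  qed auto
  finally show "((\<lambda>es. ?T es * (\<Prod>i<Suc n. (xs ! i) powi (es ! i))) has_sum
      F (tl xs) * (1 / (hd xs - tl xs ! k)) ^ Suc j) {es. length es = Suc n}"
    by (simp add: xs_eq power_one_over mult.commute del: prod.lessThan_Suc)
qed

text \<open>The same function with a new first variable on which it does not depend, so that only the power
  \<open>x^0\<close> occurs.\<close>

lemma expands_as_tl:
  assumes "expands_as n S F"
  shows "expands_as (Suc n) (\<lambda>es. if hd es = 0 then S (tl es) else 0) (\<lambda>ys. F (tl ys))"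
  unfolding expands_as_def
proof
  fix xs assume xs: "xs \<in> expansion_domain (Suc n)"
  then obtain x ys where xs_eq: "xs = x # ys"
    by (cases xs) (auto simp: expansion_domain_def)
  have ys: "ys \<in> expansion_domain n"
    using xs by (auto simp: xs_eq expansion_domain_Cons)
  let ?f = "\<lambda>es. (if hd es = 0 then S (tl es) else 0) * (\<Prod>i<Suc n. (xs ! i) powi (es ! i))"
  have "((\<lambda>es. S es * (\<Prod>i<n. (ys ! i) powi (es ! i))) has_sum F ys) {es. length es = n}"
    by (rule expands_asD[OF assms ys])
  also have "?this \<longleftrightarrow> (?f has_sum F ys) ((#) 0 ` {es. length es = n})"
    by (subst has_sum_reindex)
       (auto simp: o_def xs_eq prod.lessThan_Suc_shift simp del: prod.lessThan_Suc)
  also have "\<dots> \<longleftrightarrow> (?f has_sum F ys) {es. length es = Suc n}"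
    by (rule has_sum_cong_neutral) (auto simp: length_Suc_conv)
  finally show "(?f has_sum F (tl xs)) {es. length es = Suc n}"
    by (simp add: xs_eq del: prod.lessThan_Suc)
qed

section \<open>Kernels\<close>

lemma higher_pderiv_monom_over_fact:
  fixes c :: complex
  shows "smult (1 / fact j) ((pderiv ^^ j) (monom c n)) = monom (c * of_nat (n choose j)) (n - j)"
proof (rule poly_eqI)
  fix i
  have "pochhammer (of_nat (Suc i)) j = fact j * (of_nat ((i + j) choose j) :: complex)"
    using gbinomial_pochhammer'[of "of_nat (i + j) :: complex" j]
    by (simp add: field_simps binomial_gbinomial)
  then show "coeff (smult (1 / fact j) ((pderiv ^^ j) (monom c n))) i =
      coeff (monom (c * of_nat (n choose j)) (n - j)) i"
    by (cases "j \<le> n") (auto simp: coeff_higher_pderiv binomial_eq_0)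
qed

lemma smult_sum_right: "smult c (\<Sum>i\<in>I. p i) = (\<Sum>i\<in>I. smult c (p i))"
  by (induction I rule: infinite_finite_induct) (auto simp: smult_add_right)

text \<open>When \<open>l < j\<close> the truncated exponent \<open>l - j\<close> is harmless, as the binomial coefficient is \<open>0\<close>.\<close>

lemma formal_pi_kernel_deriv_eq:
  "formal_pi_kernel_deriv N f j a =
     (if a < 0 then monom (of_nat (nat (- a - 1) choose j)) (nat (- a - 1) - j) else 0) +
     (\<Sum>l\<le>2 * N - 2. monom (f l a * of_nat (l choose j)) (l - j))"
  unfolding formal_pi_kernel_deriv_def formal_pi_kernel_def
  by (simp add: higher_pderiv_add higher_pderiv_sum smult_add_right
      higher_pderiv_monom_over_fact smult_sum_right)

lemma higher_deriv_simple_pole_plus_poly: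
  fixes x y :: complex
  assumes "y \<noteq> x"
  shows "(deriv ^^ j) (\<lambda>y. 1 / (x - y) + poly q y) y =
    fact j / (x - y) ^ Suc j + poly ((pderiv ^^ j) q) y"
  using assms
proof (induction j arbitrary: y)
  case (Suc j)
  have "eventually (\<lambda>z. z \<in> - {x}) (nhds y)"
    using Suc.prems by (intro eventually_nhds_in_open) auto
  then have "eventually (\<lambda>z. (deriv ^^ j) (\<lambda>y. 1 / (x - y) + poly q y) z =
      fact j / (x - z) ^ Suc j + poly ((pderiv ^^ j) q) z) (nhds y)"
    by eventually_elim (use Suc.IH in auto)
  then have "deriv ((deriv ^^ j) (\<lambda>y. 1 / (x - y) + poly q y)) y =
      deriv (\<lambda>z. fact j / (x - z) ^ Suc j + poly ((pderiv ^^ j) q) z) y"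
    by (intro deriv_cong_ev) auto
  also have "((\<lambda>z. fact j / (x - z) ^ Suc j + poly ((pderiv ^^ j) q) z) has_field_derivative
      fact (Suc j) / (x - y) ^ Suc (Suc j) + poly (pderiv ((pderiv ^^ j) q)) y) (at y)"
    using Suc.prems
    by (auto intro!: derivative_eq_intros poly_DERIV simp del: power_Suc simp: field_simps)
       (simp add: field_simps)
  then have "deriv (\<lambda>z. fact j / (x - z) ^ Suc j + poly ((pderiv ^^ j) q) z) y =
      fact (Suc j) / (x - y) ^ Suc (Suc j) + poly (pderiv ((pderiv ^^ j) q)) y"
    by (rule DERIV_imp_deriv)
  finally show ?case by simp
qed simp

lemma pi_kernel_deriv_eq:
  assumes "y \<noteq> x"
  shows "pi_kernel_deriv N g j x y =
    1 / (x - y) ^ Suc j + (\<Sum>l\<le>2 * N - 2. g l x * of_nat (l choose j) * y ^ (l - j))"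
proof -
  define q where "q = (\<Sum>l\<le>2 * N - 2. monom (g l x) l)"
  have "pi_kernel N g x = (\<lambda>y. 1 / (x - y) + poly q y)"
    by (simp add: pi_kernel_def q_def poly_sum poly_monom fun_eq_iff)
  then have "pi_kernel_deriv N g j x y =
      1 / (x - y) ^ Suc j + poly (smult (1 / fact j) ((pderiv ^^ j) q)) y"
    using assms
    by (simp add: pi_kernel_deriv_def higher_deriv_simple_pole_plus_poly add_divide_distrib
        del: power_Suc)
  then show ?thesis
    by (simp add: q_def higher_pderiv_sum smult_sum_right higher_pderiv_monom_over_fact poly_sum
        poly_monom)
qed

lemma poly_times_series_eq:
  assumes "degree p \<le> d"
  shows "poly_times_series p k S es = (\<Sum>b\<le>d. coeff p b * S (es[k := es ! k - int b]))"
  unfolding poly_times_series_def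
  using assms by (intro sum.mono_neutral_left) (auto simp: coeff_eq_0)

lemma poly_times_series_add:
  "poly_times_series (p + q) k S es = poly_times_series p k S es + poly_times_series q k S es"
proof -
  let ?d = "max (degree p) (degree q)"
  have "degree (p + q) \<le> ?d" by (rule degree_add_le_max)
  then show ?thesis
    by (simp add: poly_times_series_eq[of _ ?d] ring_distribs sum.distrib)
qed

lemma poly_times_series_0 [simp]: "poly_times_series 0 k S es = 0"
  by (simp add: poly_times_series_def)

lemma poly_times_series_sum:
  "poly_times_series (\<Sum>i\<in>I. p i) k S es = (\<Sum>i\<in>I. poly_times_series (p i) k S es)"
  by (induction I rule: infinite_finite_induct) (auto simp: poly_times_series_add)

lemma poly_times_series_monom:
  "poly_times_series (monom c d) k S es = c * S (es[k := es ! k - int d])"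
  by (subst poly_times_series_eq[OF degree_monom_le]) (simp add: mult_delta_left)

section \<open>Modes of a vertex algebra\<close>

context vertex_algebra
begin

sublocale vs: Vector_Spaces.vector_space "scal V"
  by (rule vector_space)

lemma mode_add_left: "mode V (u + u') n v = mode V u n v + mode V u' n v"
  and mode_scale_left: "mode V (scal V c u) n v = scal V c (mode V u n v)"
  using mode_linear_left[of n v] unfolding Vector_Spaces.linear_iff by simp_all

lemma mode_add_right: "mode V u n (v + w) = mode V u n v + mode V u n w"
  and mode_scale_right: "mode V u n (scal V c v) = scal V c (mode V u n v)"
  using mode_linear_right[of u n] unfolding Vector_Spaces.linear_iff by simp_all

lemma mode_zero_left [simp]: "mode V 0 n v = 0"
  using mode_scale_left[of 0 0 n v] by simp

lemma mode_zero_right [simp]: "mode V u n 0 = 0"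
  using mode_scale_right[of u n 0 0] by simp

lemma mode_sum_right: "mode V u n (\<Sum>i\<in>I. w i) = (\<Sum>i\<in>I. mode V u n (w i))"
  by (induction I rule: infinite_finite_induct) (auto simp: mode_add_right)

lemma truncation_nat:
  assumes "finite A"
  shows "\<exists>J. \<forall>v\<in>A. \<forall>j\<ge>J. mode V u (int j) v = 0"
  using assms
proof (induction A)
  case (insert v A)
  then obtain J where J: "\<forall>v\<in>A. \<forall>j\<ge>J. mode V u (int j) v = 0" by blast
  obtain n0 where n0: "\<forall>n\<ge>n0. mode V u n v = 0" using truncation by blast
  show ?case
    by (rule exI[of _ "max J (nat n0)"]) (use J n0 in auto)
qed simp

text \<open>The case \<open>l = 0\<close> of the Borcherds identity, where the binomial coefficients on the right reduce
  it to a commutator. The truncation bound \<open>J\<close> is kept explicit so that later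
  sums over \<open>j\<close> have one finite range, independent of \<open>m\<close>.\<close>

lemma commutator:
  assumes "\<And>j. j \<ge> J \<Longrightarrow> mode V u (int j) v = 0"
  shows "mode V u (int m) (mode V v n w) = mode V v n (mode V u (int m) w) +
    (\<Sum>j<J. scal V (of_nat (m choose j)) (mode V (mode V u (int j) v) (int m + n - int j) w))"
proof -
  have "Sum_any (\<lambda>i::nat. scal V (of_int (int m) gchoose i)
           (mode V (mode V u (0 + int i) v) (int m + n - int i) w)) =
    (\<Sum>j<J. scal V (of_nat (m choose j)) (mode V (mode V u (int j) v) (int m + n - int j) w))"
    using assms
    by (subst Sum_any.expand_superset[of "{..<J}"]) (force simp: binomial_gbinomial not_le)+
  moreover have "Sum_any (\<lambda>i::nat. scal V ((-1) ^ i * (of_int 0 gchoose i))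
           (mode V u (int m + 0 - int i) (mode V v (n + int i) w))) =
      mode V u (int m) (mode V v n w)"
    by (subst Sum_any.expand_superset[of "{0}"]) (auto simp: gbinomial_0_left)
  moreover have "Sum_any (\<lambda>i::nat. scal V ((-1) ^ i * (of_int 0 gchoose i) * (-1) powi 0)
           (mode V v (n + 0 - int i) (mode V u (int m + int i) w))) =
      mode V v n (mode V u (int m) w)"
    by (subst Sum_any.expand_superset[of "{0}"]) (auto simp: gbinomial_0_left)
  ultimately show ?thesis
    using borcherds[of "int m" u 0 v n w] by (simp add: algebra_simps)
qed

end

text \<open>The coefficient of \<open>\<Prod>i. y\<^sub>i^(e\<^sub>i)\<close> in \<open>Y(v\<^sub>1,y\<^sub>1) \<dots> Y(v\<^sub>n,y\<^sub>n) 1\<close>.\<close>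

definition mode_word :: "('v::ab_group_add) voa_data \<Rightarrow> 'v list \<Rightarrow> int list \<Rightarrow> 'v" where
  "mode_word V vs es = foldr (\<lambda>(v, e) w. mode V v (- e - 1) w) (zip vs es) (vac V)"

lemma mode_word_simps [simp]:
  "mode_word V [] es = vac V"
  "mode_word V (v # vs) (e # es) = mode V v (- e - 1) (mode_word V vs es)"
  by (simp_all add: mode_word_def)

lemma Z0_coeff_eq: "Z0_coeff V B vs es = B (vac V) (mode_word V vs es)"
  by (simp add: Z0_coeff_def mode_word_def)

context vertex_algebra
begin

lemma mode_word_zero:
  "length vs = length es \<Longrightarrow> 0 \<in> set vs \<Longrightarrow> mode_word V vs es = 0"
  by (induction vs es rule: list_induct2) auto

text \<open>For \<open>m \<ge> 0\<close> the mode \<open>u(m)\<close> kills the vacuum, so only the commutators remain when it is moved to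
  the right. The commutator with the \<open>k\<close>-th mode replaces \<open>v\<^sub>k\<close> by \<open>u(j)v\<^sub>k\<close> and shifts the \<open>k\<close>-th
  exponent.\<close>

lemma mode_mode_word:
  assumes "length vs = length es" and "\<And>v j. v \<in> set vs \<Longrightarrow> j \<ge> J \<Longrightarrow> mode V u (int j) v = 0"
  shows "mode V u (int m) (mode_word V vs es) =
    (\<Sum>k<length vs. \<Sum>j<J. scal V (of_nat (m choose j))
       (mode_word V (vs[k := mode V u (int j) (vs ! k)]) (es[k := es ! k - (int m - int j)])))"
  using assms
proof (induction vs es rule: list_induct2)
  case Nil
  then show ?case by (simp add: creation_nonneg)
next
  case (Cons v vs e es)
  have exponent: "int m + (- e - 1) - int j = - (e - (int m - int j)) - 1" for j
    by simp
  have "mode V u (int m) (mode V v (- e - 1) (mode_word V vs es)) =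
      mode V v (- e - 1) (mode V u (int m) (mode_word V vs es)) +
      (\<Sum>j<J. scal V (of_nat (m choose j)) (mode V (mode V u (int j) v)
         (int m + (- e - 1) - int j) (mode_word V vs es)))"
    using Cons.prems by (intro commutator) auto
  also have "mode V u (int m) (mode_word V vs es) = (\<Sum>k<length vs. \<Sum>j<J. scal V (of_nat (m choose j))
       (mode_word V (vs[k := mode V u (int j) (vs ! k)]) (es[k := es ! k - (int m - int j)])))"
    using Cons.prems by (intro Cons.IH) auto
  finally show ?case
    unfolding exponent
    by (simp add: sum.lessThan_Suc_shift mode_sum_right mode_scale_right add.commute
        del: sum.lessThan_Suc)
qed

end

section \<open>The linear functional of the vacuum\<close>

context vertex_operator_algebra
begin

text \<open>\<open>L(0)\<close> is the mode \<open>\<omega>(1)\<close>, and in its commutator with \<open>u(n)\<close> only \<open>\<omega>(0)u = L(-1)u\<close> and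
  \<open>\<omega>(1)u = L(0)u\<close> have non-zero binomial coefficients.\<close>

lemma L0_mode:
  assumes "u \<in> weight_space V N"
  shows "L V 0 (mode V u n w) =
    mode V u n (L V 0 w) + scal V (of_int (N - n - 1)) (mode V u n w)"
proof -
  obtain J where J: "\<And>j. j \<ge> J \<Longrightarrow> mode V (conf V) (int j) u = 0"
    using truncation_nat[of "{u}" "conf V"] by auto
  let ?f = "\<lambda>j. scal V (of_nat (1 choose j))
       (mode V (mode V (conf V) (int j) u) (int 1 + n - int j) w)"
  have "mode V (conf V) (int 1) (mode V u n w) = mode V u n (mode V (conf V) (int 1) w) +
      (\<Sum>j<max J 2. ?f j)"
    by (rule commutator) (use J in auto)
  also have "(\<Sum>j<max J 2. ?f j) = (\<Sum>j<2. ?f j)"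
    by (rule sum.mono_neutral_right) (auto simp: binomial_eq_0)
  also have "\<dots> = scal V (of_int (N - n - 1)) (mode V u n w)"
    using translation[of u "1 + n" w] assms
    by (simp add: numeral_2_eq_2 L_def weight_space_def mode_scale_left
        flip: vs.scale_left_distrib)
  finally show ?thesis by (simp add: L_def)
qed

lemma L_vac: "n \<ge> -1 \<Longrightarrow> L V n (vac V) = 0"
  by (simp add: L_def creation_nonneg)

text \<open>Both follow from \<open>\<omega> = L(-2)1\<close> and the Virasoro relations, since \<open>L(-1)\<close>, \<open>L(0)\<close> and \<open>L(1)\<close>
  annihilate the vacuum.\<close>

lemma conf_quasiprimary: "conf V \<in> weight_space V 2" "L V 1 (conf V) = 0"
proof -
  have conf: "conf V = L V (-2) (vac V)"
    using creation[of "conf V"] by (simp add: L_def)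
  obtain c where vir: "\<And>m n v. L V m (L V n v) - L V n (L V m v)
         = scal V (of_int (m - n)) (L V (m + n) v)
           + (if m + n = 0 then scal V ((of_int m ^ 3 - of_int m) / 12 * c) v else 0)"
    using virasoro by blast
  have L0: "L V n 0 = 0" for n by (simp add: L_def)
  show "conf V \<in> weight_space V 2" "L V 1 (conf V) = 0"
    using vir[of 0 "-2" "vac V"] vir[of 1 "-2" "vac V"]
    by (simp_all add: weight_space_def L_vac L0 flip: conf)
qed

lemma adjoint_mode_quasiprimary:
  assumes "L V 1 u = 0"
  shows "adjoint_mode V N u n w = scal V ((-1) powi N) (mode V u (2 * N - n - 2) w)"
proof -
  have "(L V 1 ^^ k) u = 0" if "k \<noteq> 0" for k
    using that
  proof (induction k)
    case (Suc k)
    then show ?case using assms by (cases "k = 0") (auto simp: L_def)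
  qed simp
  note eq_0 = this
  show ?thesis
    unfolding adjoint_mode_def
    by (subst Sum_any.expand_superset[of "{0}"], simp, rule subsetI, rule ccontr)
       (simp_all add: eq_0)
qed

lemma weight_induct [case_names weight zero add scale]:
  assumes "\<And>N u. u \<in> weight_space V N \<Longrightarrow> P u"
    and "P 0" and "\<And>u v. P u \<Longrightarrow> P v \<Longrightarrow> P (u + v)" and "\<And>c u. P u \<Longrightarrow> P (scal V c u)"
  shows "P u"
proof -
  have "u \<in> vs.span (\<Union>n. weight_space V n)" using grading by simp
  then show ?thesis
    by (rule vs.span_induct) (use assms in \<open>auto simp: vs.subspace_def\<close>)
qed

end

locale CFT_voa_with_form = vertex_operator_algebra V
  for V :: "('v::ab_group_add) voa_data" +
  fixes B :: "'v \<Rightarrow> 'v \<Rightarrow> complex"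
  assumes CFT: "strong_CFT_type V" and form: "normalized_invariant_form V B"
begin

lemma form_linear_right: "Vector_Spaces.linear (scal V) (*) (B v)"
  and form_linear_left: "Vector_Spaces.linear (scal V) (*) (\<lambda>v. B v w)"
  and form_vac: "B (vac V) (vac V) = 1"
  using form unfolding normalized_invariant_form_def by simp_all

lemma form_invariant:
  assumes "u \<in> weight_space V N"
  shows "B (mode V u n v) w = B v (adjoint_mode V N u n w)"
proof -
  have "\<forall>N. \<forall>u \<in> weight_space V N. \<forall>n v w. B (mode V u n v) w = B v (adjoint_mode V N u n w)"
    using form unfolding normalized_invariant_form_def by (elim conjE)
  then show ?thesis using assms by simp
qed

lemma form_add_right: "B v (w + w') = B v w + B v w'"
  and form_scale_right: "B v (scal V c w) = c * B v w"
  using form_linear_right[of v] unfolding Vector_Spaces.linear_iff by simp_all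

lemma form_scale_left: "B (scal V c v) w = c * B v w"
  using form_linear_left[of w] unfolding Vector_Spaces.linear_iff by simp

lemma form_zero_right [simp]: "B v 0 = 0"
  using form_scale_right[of v 0 0] by simp

lemma form_zero_left [simp]: "B 0 v = 0"
  using form_scale_left[of 0 0 v] by simp

lemma form_sum_right: "B v (\<Sum>i\<in>I. w i) = (\<Sum>i\<in>I. B v (w i))"
  by (induction I rule: infinite_finite_induct) (auto simp: form_add_right)

lemma form_quasiprimary:
  assumes "u \<in> weight_space V N" "L V 1 u = 0"
  shows "B (mode V u n v) w = (-1) powi N * B v (mode V u (2 * N - n - 2) w)"
  using assms by (simp add: form_invariant adjoint_mode_quasiprimary form_scale_right)

text \<open>Moving \<open>u(m)\<close> to the left factor turns it into \<open>\<plusminus>u(2N-2-m)\<close>, a non-negative mode acting on the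
  vacuum.\<close>

lemma vac_mode_quasiprimary_eq_0:
  assumes "u \<in> weight_space V N" "L V 1 u = 0" "m \<le> 2 * N - 2"
  shows "B (vac V) (mode V u m w) = 0"
  using form_quasiprimary[OF assms(1,2), of "2 * N - 2 - m" "vac V" w] assms(3)
  by (simp add: creation_nonneg)

text \<open>\<open>L(0)\<close> is self-adjoint because \<open>\<omega>\<close> is quasiprimary of weight 2, and it annihilates the vacuum.\<close>

lemma vac_weight_eq_0:
  assumes "w \<in> weight_space V M" "M \<noteq> 0"
  shows "B (vac V) w = 0"
proof -
  have "B (L V 0 (vac V)) w = B (vac V) (L V 0 w)"
    using form_quasiprimary[OF conf_quasiprimary, of 1 "vac V" w] by (simp add: L_def)
  then show ?thesis
    using assms by (simp add: L_vac weight_space_def form_scale_right)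
qed

lemma vac_mode_weight_eq_0:
  assumes "u \<in> weight_space V N" "w \<in> weight_space V M" "N + M \<noteq> n + 1"
  shows "B (vac V) (mode V u n w) = 0"
proof (rule vac_weight_eq_0)
  show "mode V u n w \<in> weight_space V (M + (N - n - 1))"
    using L0_mode[OF assms(1), of n w] assms(2)
    by (simp add: weight_space_def mode_scale_right flip: vs.scale_left_distrib)
qed (use assms(3) in simp)

lemma weight_negative: "v \<in> weight_space V n \<Longrightarrow> n < 0 \<Longrightarrow> v = 0"
  using CFT unfolding strong_CFT_type_def by blast

text \<open>By linearity \<open>u\<close> and \<open>w\<close> may be taken homogeneous of weights \<open>N\<close> and \<open>M\<close>. Then \<open>u(n)w\<close> has weight
  \<open>N + M - n - 1\<close>, which for \<open>n < 0\<close> and non-negative weights is zero only when \<open>N = M = 0\<close> and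
  \<open>n = -1\<close>. For \<open>N = 0\<close> the vector \<open>u\<close> is a multiple of the vacuum, whose modes are known.\<close>

lemma vac_mode_negative:
  assumes "n < 0"
  shows "B (vac V) (mode V u n w) = (if n = -1 then B (vac V) u * B (vac V) w else 0)"
proof (induction u rule: weight_induct)
  case (weight N u)
  show ?case
  proof (cases "N = 0")
    case True
    then have "u \<in> vs.span {vac V}"
      using weight CFT by (simp add: strong_CFT_type_def)
    then obtain c where "u = scal V c (vac V)"
      unfolding vs.span_singleton by blast
    then show ?thesis by (simp add: mode_scale_left vacuum form_scale_right form_vac)
  next
    case False
    have "B (vac V) (mode V u n w) = 0"
    proof (induction w rule: weight_induct)
      case (weight M w)
      show ?case
      proof (cases "N < 0 \<or> M < 0")
        case True
        then show ?thesis using weight_negative weight \<open>u \<in> weight_space V N\<close> by fastforce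
      next
        case nonneg: False
        then show ?thesis
          using assms False by (intro vac_mode_weight_eq_0[OF \<open>u \<in> weight_space V N\<close> weight]) auto
      qed
    qed (simp_all add: mode_add_right form_add_right mode_scale_right form_scale_right)
    then show ?thesis using vac_weight_eq_0[OF weight False] by simp
  qed
qed (simp_all add: mode_add_left form_add_right mode_scale_left form_scale_right ring_distribs)

end

context CFT_voa_with_form
begin

section \<open>Recursion for correlation functions of arbitrary vectors\<close>

lemma Z0_coeff_zero:
  assumes "length es = length vs" "0 \<in> set vs"
  shows "Z0_coeff V B vs es = 0"
  using assms by (simp add: Z0_coeff_eq mode_word_zero)

lemma vac_mode_mode_word:
  assumes "length es = length vs" and "\<And>v j. v \<in> set vs \<Longrightarrow> j \<ge> J \<Longrightarrow> mode V u (int j) v = 0"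
  shows "B (vac V) (mode V u (int m) (mode_word V vs es)) =
    (\<Sum>k<length vs. \<Sum>j<J. of_nat (m choose j) *
       Z0_coeff V B (vs[k := mode V u (int j) (vs ! k)]) (es[k := es ! k - (int m - int j)]))"
  using assms
  by (subst mode_mode_word[where J = J])
     (auto simp: form_sum_right form_scale_right Z0_coeff_eq)

text \<open>The exponent \<open>a\<close> belongs to the mode \<open>u(-a-1)\<close>, so \<open>a \<ge> 0\<close> is the range of
  \<open>vac_mode_negative\<close> and \<open>a < 0\<close> that of the commutator formula.\<close>

lemma Z0_coeff_Cons:
  assumes "length es = length vs" and "\<And>v j. v \<in> set vs \<Longrightarrow> j \<ge> J \<Longrightarrow> mode V u (int j) v = 0"
  shows "Z0_coeff V B (u # vs) (a # es) =
    (if a = 0 then B (vac V) u * Z0_coeff V B vs es else 0) +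
    (\<Sum>k<length vs. \<Sum>j<J. if a < 0 then of_nat (nat (- a - 1) choose j) *
       Z0_coeff V B (vs[k := mode V u (int j) (vs ! k)]) (es[k := es ! k - (- a - 1 - int j)]) else 0)"
proof (cases "a < 0")
  case True
  have "B (vac V) (mode V u (int (nat (- a - 1))) (mode_word V vs es)) =
      (\<Sum>k<length vs. \<Sum>j<J. of_nat (nat (- a - 1) choose j) *
       Z0_coeff V B (vs[k := mode V u (int j) (vs ! k)])
         (es[k := es ! k - (int (nat (- a - 1)) - int j)]))"
    using assms by (rule vac_mode_mode_word)
  then show ?thesis using True by (simp add: Z0_coeff_eq)
next
  case False
  then show ?thesis by (simp add: Z0_coeff_eq vac_mode_negative)
qed

text \<open>The right-hand side of the recursion with kernel \<open>1/(x-y)\<close>, valid for arbitrary \<open>u\<close>. The first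
  term is present because \<open>u\<close> may have a component along the vacuum.\<close>

definition Z0_recursion :: "nat \<Rightarrow> 'v \<Rightarrow> 'v list \<Rightarrow> complex list \<Rightarrow> complex" where
  "Z0_recursion J u vs ys = B (vac V) u * Z0 V B vs (tl ys) +
     (\<Sum>k<length vs. \<Sum>j<J. Z0 V B (vs[k := mode V u (int j) (vs ! k)]) (tl ys) *
        (1 / (hd ys - tl ys ! k)) ^ Suc j)"

text \<open>\<open>Z0\<close> is given by a definite description; this predicate says that the object described exists.\<close>

definition Z0_is_expansion :: "'v list \<Rightarrow> bool" where
  "Z0_is_expansion vs \<longleftrightarrow>
     rational_fun (length vs) (Z0 V B vs) \<and> expands_as (length vs) (Z0_coeff V B vs) (Z0 V B vs)"

lemma Z0_is_expansionI:
  assumes "rational_fun (length vs) F" "expands_as (length vs) (Z0_coeff V B vs) F"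
  shows "Z0_is_expansion vs"
proof -
  have "F ys = Z0 V B vs ys" if "length ys = length vs" "distinct ys" for ys
    using Z0_eq[OF assms(2,1) that] by simp
  then show ?thesis
    unfolding Z0_is_expansion_def
    using rational_fun_cong[OF assms(1)] expands_as_cong[OF assms(2)]
    by (simp add: expansion_domain_length expansion_domain_distinct)
qed

lemma Z0_recursion_expansion:
  assumes "\<And>ws. length ws = length vs \<Longrightarrow> Z0_is_expansion ws"
    and "\<And>v j. v \<in> set vs \<Longrightarrow> j \<ge> J \<Longrightarrow> mode V u (int j) v = 0"
  shows "rational_fun (length (u # vs)) (Z0_recursion J u vs)"
    and "expands_as (length (u # vs)) (Z0_coeff V B (u # vs)) (Z0_recursion J u vs)"
proof -
  let ?vs = "\<lambda>k j. vs[k := mode V u (int j) (vs ! k)]"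
  have rat: "rational_fun (length vs) (Z0 V B ws)"
    and exp: "expands_as (length vs) (Z0_coeff V B ws) (Z0 V B ws)"
    if "length ws = length vs" for ws
    using assms(1)[OF that] that by (auto simp: Z0_is_expansion_def)
  show "rational_fun (length (u # vs)) (Z0_recursion J u vs)"
    unfolding Z0_recursion_def list.size add_Suc_right add_0_right
    by (intro rational_fun_add rational_fun_mult rational_fun_sum rational_fun_power
          rational_fun_pole rational_fun_tl rational_fun_polynomial[OF polynomial_fun_const] rat) auto
  let ?S = "\<lambda>es. (if hd es = 0 then B (vac V) u * Z0_coeff V B vs (tl es) else 0) +
      (\<Sum>k<length vs. \<Sum>j<J. if hd es < 0 then of_nat (nat (- hd es - 1) choose j) *
         Z0_coeff V B (?vs k j) ((tl es)[k := tl es ! k - (- hd es - 1 - int j)]) else 0)"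
  have "expands_as (Suc (length vs)) ?S (Z0_recursion J u vs)"
    unfolding Z0_recursion_def
    by (intro expands_as_add expands_as_sum expands_as_pole exp
        expands_as_tl[OF expands_as_cmult]) auto
  moreover have "?S es = Z0_coeff V B (u # vs) es" if len: "length es = Suc (length vs)" for es
  proof -
    obtain a es' where es: "es = a # es'" "length es' = length vs"
      using len by (cases es) auto
    show ?thesis
      unfolding es(1) list.sel using es(2) assms(2) by (rule Z0_coeff_Cons[symmetric])
  qed
  ultimately show "expands_as (length (u # vs)) (Z0_coeff V B (u # vs)) (Z0_recursion J u vs)"
    using expands_as_cong by simp
qed

text \<open>Removing the first insertion expresses the coefficients through correlation functions with one
  insertion less but with new vectors \<open>u(j)v\<^sub>k\<close>, so the induction is over all lists of a given
  length.\<close>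

lemma Z0_expansion: "Z0_is_expansion vs"
proof (induction "length vs" arbitrary: vs)
  case 0
  have "expands_as 0 (Z0_coeff V B []) (\<lambda>_. Z0_coeff V B [] [])"
    using has_sum_finite[of "{[]}" "Z0_coeff V B []"] by (simp add: expands_as_def)
  then show ?case
    using 0 by (intro Z0_is_expansionI[where F = "\<lambda>_. Z0_coeff V B [] []"]
      rational_fun_polynomial[OF polynomial_fun_const]) simp_all
next
  case (Suc n)
  then obtain u us where vs: "vs = u # us" "n = length us"
    by (cases vs) auto
  obtain J where "\<And>v j. v \<in> set us \<Longrightarrow> j \<ge> J \<Longrightarrow> mode V u (int j) v = 0"
    using truncation_nat[of "set us" u] by auto
  from Z0_recursion_expansion[OF Suc(1) this] show ?case
    unfolding vs by (intro Z0_is_expansionI) (auto simp: vs)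
qed

lemma Z0_rational_fun: "rational_fun (length vs) (Z0 V B vs)"
  and Z0_expands_as: "expands_as (length vs) (Z0_coeff V B vs) (Z0 V B vs)"
  using Z0_expansion by (auto simp: Z0_is_expansion_def)

lemma Z0_Cons:
  assumes "\<And>v j. v \<in> set vs \<Longrightarrow> j \<ge> J \<Longrightarrow> mode V u (int j) v = 0"
    and "length ys = length vs" "distinct (x # ys)"
  shows "Z0 V B (u # vs) (x # ys) = B (vac V) u * Z0 V B vs ys +
     (\<Sum>k<length vs. \<Sum>j<J. Z0 V B (vs[k := mode V u (int j) (vs ! k)]) ys *
        (1 / (x - ys ! k)) ^ Suc j)"
proof -
  have "Z0 V B (u # vs) (x # ys) = Z0_recursion J u vs (x # ys)"
    by (rule Z0_eq) (use assms Z0_recursion_expansion[OF Z0_expansion assms(1)] in auto)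
  then show ?thesis by (simp add: Z0_recursion_def)
qed

lemma Z0_zero:
  assumes "0 \<in> set vs" "length ys = length vs" "distinct ys"
  shows "Z0 V B vs ys = 0"
proof (rule Z0_eq[where F = "\<lambda>_. 0"])
  show "expands_as (length vs) (Z0_coeff V B vs) (\<lambda>_. 0)"
    by (rule expands_as_cong[OF expands_as_zero]) (simp_all add: Z0_coeff_zero assms(1))
qed (use assms in \<open>auto intro: rational_fun_polynomial polynomial_fun_const\<close>)

section \<open>Quasiprimary insertions\<close>

text \<open>The sum is \<open>\<langle>1, u(l)w\<rangle>\<close> for a word \<open>w\<close>, written out by the commutator formula. It is the factor
  of \<open>f\<^sub>l(x)\<close> in the formal recursion.\<close>

lemma Z0_coeff_identity:
  assumes "quasiprimary V N u" "l \<le> 2 * N - 2" "N \<ge> 1" "length es = length vs"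
    and "\<And>v j. v \<in> set vs \<Longrightarrow> j \<ge> J \<Longrightarrow> mode V u (int j) v = 0"
  shows "(\<Sum>k<length vs. \<Sum>j<J. of_nat (l choose j) *
    Z0_coeff V B (vs[k := mode V u (int j) (vs ! k)]) (es[k := es ! k - int (l - j)])) = 0"
proof -
  have "int l \<le> 2 * int N - 2" using assms(2,3) by linarith
  then have "B (vac V) (mode V u (int l) (mode_word V vs es)) = 0"
    using assms(1) unfolding quasiprimary_def by (intro vac_mode_quasiprimary_eq_0) auto
  moreover have "of_nat (l choose j) * Z0_coeff V B ws (es[k := es ! k - int (l - j)]) =
      of_nat (l choose j) * Z0_coeff V B ws (es[k := es ! k - (int l - int j)])" for j ws k
    by (cases "j \<le> l") (auto simp: of_nat_diff binomial_eq_0)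
  ultimately show ?thesis
    by (simp only: vac_mode_mode_word[OF assms(4,5)])
qed

text \<open>The left-hand side is a rational function whose expansion has the coefficients of
  \<open>Z0_coeff_identity\<close>, all of them zero.\<close>

lemma Z0_identity:
  assumes "quasiprimary V N u" "l \<le> 2 * N - 2" "N \<ge> 1"
    and "\<And>v j. v \<in> set vs \<Longrightarrow> j \<ge> J \<Longrightarrow> mode V u (int j) v = 0"
    and "length ys = length vs" "distinct ys"
  shows "(\<Sum>k<length vs. \<Sum>j<J. of_nat (l choose j) * (ys ! k ^ (l - j) *
    Z0 V B (vs[k := mode V u (int j) (vs ! k)]) ys)) = 0"
proof -
  let ?vs = "\<lambda>k j. vs[k := mode V u (int j) (vs ! k)]"
  let ?F = "\<lambda>ys. \<Sum>k<length vs. \<Sum>j<J. of_nat (l choose j) *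
    (ys ! k ^ (l - j) * Z0 V B (?vs k j) ys)"
  have exp: "expands_as (length vs) (Z0_coeff V B (?vs k j)) (Z0 V B (?vs k j))"
    and rat: "rational_fun (length vs) (Z0 V B (?vs k j))" for k j
    using Z0_expands_as[of "?vs k j"] Z0_rational_fun[of "?vs k j"] by simp_all
  have "expands_as (length vs) (\<lambda>es. \<Sum>k<length vs. \<Sum>j<J. of_nat (l choose j) *
      Z0_coeff V B (?vs k j) (es[k := es ! k - int (l - j)]))
    (\<lambda>ys. \<Sum>k<length vs. \<Sum>j<J. of_nat (l choose j) *
      (ys ! k powi int (l - j) * Z0 V B (?vs k j) ys))"
    by (intro expands_as_sum expands_as_cmult expands_as_shift exp) auto
  then have "expands_as (length vs) (\<lambda>_. 0) ?F"
    by (rule expands_as_cong) (use Z0_coeff_identity[OF assms(1-3) _ assms(4)] in simp_all)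
  moreover have "rational_fun (length vs) ?F"
    by (intro rational_fun_sum rational_fun_mult rational_fun_power rat
        rational_fun_polynomial[OF polynomial_fun_const]
        rational_fun_polynomial[OF polynomial_fun_nth]) auto
  ultimately show ?thesis
    using expands_as_unique[OF _ expands_as_zero _ rational_fun_polynomial[OF polynomial_fun_const]]
      assms(5,6) by blast
qed

lemma vac_quasiprimary_eq_0:
  assumes "quasiprimary V N u" "N \<ge> 1"
  shows "B (vac V) u = 0"
  using assms vac_weight_eq_0[of u "int N"] by (auto simp: quasiprimary_def)

lemma Z0_coeff_quasiprimary:
  assumes "quasiprimary V N u" "N \<ge> 1" "length es = length vs"
  shows "Z0_coeff V B (u # vs) (a # es) =
    (\<Sum>k<length vs. Sum_any (\<lambda>j::nat.
       poly_times_series (formal_pi_kernel_deriv N f j a) k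
         (Z0_coeff V B (vs[k := mode V u (int j) (vs ! k)])) es))"
proof -
  obtain J where J: "\<And>v j. v \<in> set vs \<Longrightarrow> j \<ge> J \<Longrightarrow> mode V u (int j) v = 0"
    using truncation_nat[of "set vs" u] by auto
  let ?m = "nat (- a - 1)"
  let ?S = "\<lambda>k j d. Z0_coeff V B (vs[k := mode V u (int j) (vs ! k)]) (es[k := es ! k - d])"
  let ?p = "\<lambda>k j. poly_times_series (formal_pi_kernel_deriv N f j a) k
         (Z0_coeff V B (vs[k := mode V u (int j) (vs ! k)])) es"
  have S0: "?S k j d = 0" if "k < length vs" "j \<ge> J" for k j d
    by (rule Z0_coeff_zero) (use that J assms(3) in \<open>auto simp: set_update_memI\<close>)
  have p: "?p k j = (if a < 0 then of_nat (?m choose j) * ?S k j (- a - 1 - int j) else 0) +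
      (\<Sum>l\<le>2 * N - 2. f l a * (of_nat (l choose j) * ?S k j (int (l - j))))" for k j
  proof -
    have "of_nat (?m choose j) * ?S k j (int (?m - j)) =
        of_nat (?m choose j) * ?S k j (- a - 1 - int j)" if "a < 0"
      using that by (cases "j \<le> ?m") (auto simp: of_nat_diff binomial_eq_0)
    then show ?thesis
      by (simp add: formal_pi_kernel_deriv_eq poly_times_series_add poly_times_series_sum
          poly_times_series_monom mult.assoc)
  qed
  have "(\<Sum>k<length vs. Sum_any (?p k)) = (\<Sum>k<length vs. \<Sum>j<J. ?p k j)"
  proof (rule sum.cong)
    fix k assume "k \<in> {..<length vs}"
    then have "?p k j = 0" if "j \<ge> J" for j using that by (simp add: p S0)
    then show "Sum_any (?p k) = (\<Sum>j<J. ?p k j)"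
      by (intro Sum_any.expand_superset) (auto simp: not_le[symmetric])
  qed simp
  also have "\<dots> = (\<Sum>k<length vs. \<Sum>j<J. if a < 0 then of_nat (?m choose j) * ?S k j (- a - 1 - int j) else 0) +
      (\<Sum>k<length vs. \<Sum>j<J. \<Sum>l\<le>2 * N - 2. f l a * (of_nat (l choose j) * ?S k j (int (l - j))))"
    by (simp only: p sum.distrib)
  also have "(\<Sum>k<length vs. \<Sum>j<J. \<Sum>l\<le>2 * N - 2. f l a * (of_nat (l choose j) * ?S k j (int (l - j)))) =
      (\<Sum>l\<le>2 * N - 2. f l a * (\<Sum>k<length vs. \<Sum>j<J. of_nat (l choose j) * ?S k j (int (l - j))))"
    by (simp only: sum_distrib_left sum.swap[of _ "{..2 * N - 2}"])
  also have "\<dots> = 0"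
    using Z0_coeff_identity[OF assms(1) _ assms(2,3) J] by (intro sum.neutral) simp
  also have "(\<Sum>k<length vs. \<Sum>j<J. if a < 0 then of_nat (?m choose j) * ?S k j (- a - 1 - int j) else 0) + 0 =
      Z0_coeff V B (u # vs) (a # es)"
    using Z0_coeff_Cons[OF assms(3) J, where a = a] vac_quasiprimary_eq_0[OF assms(1,2)] by simp
  finally show ?thesis ..
qed

lemma Z0_quasiprimary:
  assumes "quasiprimary V N u" "N \<ge> 1" "length ys = length vs" "distinct (x # ys)"
  shows "Z0 V B (u # vs) (x # ys) =
    (\<Sum>k<length vs. Sum_any (\<lambda>j::nat.
       pi_kernel_deriv N g j x (ys ! k) * Z0 V B (vs[k := mode V u (int j) (vs ! k)]) ys))"
proof -
  obtain J where J: "\<And>v j. v \<in> set vs \<Longrightarrow> j \<ge> J \<Longrightarrow> mode V u (int j) v = 0"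
    using truncation_nat[of "set vs" u] by auto
  let ?Z = "\<lambda>k j. Z0 V B (vs[k := mode V u (int j) (vs ! k)]) ys"
  let ?p = "\<lambda>k j. pi_kernel_deriv N g j x (ys ! k) * ?Z k j"
  have Z: "?Z k j = 0" if "k < length vs" "j \<ge> J" for k j
    by (rule Z0_zero) (use that J assms(3,4) in \<open>auto simp: set_update_memI\<close>)
  have p: "?p k j = ?Z k j * (1 / (x - ys ! k)) ^ Suc j +
      (\<Sum>l\<le>2 * N - 2. g l x * (of_nat (l choose j) * (ys ! k ^ (l - j) * ?Z k j)))"
    if "k < length vs" for k j
  proof -
    have "ys ! k \<noteq> x" using that assms(3,4) by auto
    then show ?thesis
      by (simp add: pi_kernel_deriv_eq ring_distribs sum_distrib_left sum_distrib_right
          power_one_over mult_ac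
          del: power_Suc)
  qed
  have "(\<Sum>k<length vs. Sum_any (?p k)) = (\<Sum>k<length vs. \<Sum>j<J. ?p k j)"
  proof (rule sum.cong)
    fix k assume "k \<in> {..<length vs}"
    then have "?Z k j = 0" if "j \<ge> J" for j using that by (simp add: Z)
    then show "Sum_any (?p k) = (\<Sum>j<J. ?p k j)"
      by (intro Sum_any.expand_superset) (auto simp: not_le[symmetric])
  qed simp
  also have "\<dots> = (\<Sum>k<length vs. \<Sum>j<J. ?Z k j * (1 / (x - ys ! k)) ^ Suc j) +
      (\<Sum>k<length vs. \<Sum>j<J. \<Sum>l\<le>2 * N - 2. g l x * (of_nat (l choose j) * (ys ! k ^ (l - j) * ?Z k j)))"
    by (simp add: p sum.distrib del: power_Suc)
  also have "(\<Sum>k<length vs. \<Sum>j<J. \<Sum>l\<le>2 * N - 2. g l x * (of_nat (l choose j) * (ys ! k ^ (l - j) * ?Z k j))) =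
      (\<Sum>l\<le>2 * N - 2. g l x * (\<Sum>k<length vs. \<Sum>j<J. of_nat (l choose j) * (ys ! k ^ (l - j) * ?Z k j)))"
    by (simp only: sum_distrib_left sum.swap[of _ "{..2 * N - 2}"])
  also have "\<dots> = 0"
    using Z0_identity[OF assms(1) _ assms(2) J assms(3)] assms(4) by (intro sum.neutral) simp
  also have "(\<Sum>k<length vs. \<Sum>j<J. ?Z k j * (1 / (x - ys ! k)) ^ Suc j) + 0 =
      Z0 V B (u # vs) (x # ys)"
    using Z0_Cons[OF J assms(3,4)] vac_quasiprimary_eq_0[OF assms(1,2)] by simp
  finally show ?thesis ..
qed

end

section \<open>The recursion\<close>

theorem proposition3p4:
  fixes V :: "('v::ab_group_add) voa_data"
    and B :: "'v \<Rightarrow> 'v \<Rightarrow> complex"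
    and N :: nat and u :: 'v and vs :: "'v list"
    and f :: "nat \<Rightarrow> int \<Rightarrow> complex"
    and g :: "nat \<Rightarrow> complex \<Rightarrow> complex"
  assumes "vertex_operator_algebra V"
    and "simple_voa V"
    and "strong_CFT_type V"
    and "self_contragredient V"
    and "normalized_invariant_form V B"
    and "quasiprimary V N u" and "N \<ge> 1"
  shows
    "(\<forall>a es. length es = length vs \<longrightarrow>
        Z0_coeff V B (u # vs) (a # es) =
          (\<Sum>k<length vs. Sum_any (\<lambda>j::nat.
             poly_times_series (formal_pi_kernel_deriv N f j a) k
               (Z0_coeff V B (vs[k := mode V u (int j) (vs ! k)])) es)))
     \<and>
     (\<forall>x ys. length ys = length vs \<and> distinct (x # ys) \<longrightarrow>
        Z0 V B (u # vs) (x # ys) =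
          (\<Sum>k<length vs. Sum_any (\<lambda>j::nat.
             pi_kernel_deriv N g j x (ys ! k)
               * Z0 V B (vs[k := mode V u (int j) (vs ! k)]) ys)))"
proof -
  interpret vertex_operator_algebra V by fact
  interpret CFT_voa_with_form V B
    by unfold_locales fact+
  show ?thesis
    using Z0_coeff_quasiprimary[OF assms(6,7)] Z0_quasiprimary[OF assms(6,7)] by blast
qed

end
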